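(* Let $X=CI(d_1,d_2)\subseteq\mathbb{P}^2$ be a complete intersection of points with $2\leq d_1\leq d_2$, and suppose $X$ splits as $X=X_1\cup X_2=CI(d_1-1,d_2)\cup CI(1,d_2)$. Let $m\geq 1$. If $Z=\{X;m\}$ and $Y=Z\setminus\{(P,m)\}$ with $P\in X_2$, then \[ \operatorname{ri}(Y)=d_1+md_2-3. \]
   Context: $k$ is an algebraically closed field of characteristic $0$, $R=k[x_0,x_1,x_2]$ has the standard grading, and $\mathbb{P}^2=\mathbb{P}^2_k$. A complete intersection of points of type $(e_1,e_2)$ (in any order), denoted $CI(e_1,e_2)\subseteq\mathbb{P}^2$, is a set of $e_1e_2$ reduced points whose defining ideal is $(F_1,F_2)$, where $F_1,F_2$ is a regular sequence of homogeneous forms with $\deg F_i=e_i$, this ideal being radical. That $X=CI(d_1,d_2)$ splits as $X=X_1\cup X_2=CI(d_1-1,d_2)\cup CI(1,d_2)$ means that $X$ is the disjoint union of two complete intersections of points $X_1$, $X_2$ of the indicated types. For a finite set of points $X$ and $m\geq 1$, $\{X;m\}$ denotes the fat point scheme defined by $\bigcap_{Q\in X}\wp_Q^m$, where $\wp_Q\subseteq R$ is the defining ideal of the point $Q$; for $P\in X$, $\{X;m\}\setminus\{(P,m)\}$ is the fat point scheme defined by $\bigcap_{Q\in X\setminus\{P\}}\wp_Q^m$. For a fat point scheme $W=\{(P_1,m_1),\ldots,(P_s,m_s)\}\subseteq\mathbb{P}^2$ with defining ideal $I_W=\bigcap_j\wp_{P_j}^{m_j}$, the regularity index is \[ \operatorname{ri}(W):=\min\left\{i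 \;\middle|\; \dim_k(R/I_W)_i=\deg(W):=\sum_{j=1}^s\binom{m_j+1}{2}\right\}. \] *)

theory Defs
  imports "HOL-Analysis.Analysis" "HOL-Library.Poly_Mapping"
    "HOL-Computational_Algebra.Polynomial"
begin

section \<open>Ideals of a commutative ring\<close>

lemma module_mult: "module ((*) :: 'a::comm_ring_1 \<Rightarrow> 'a \<Rightarrow> 'a)"
  by unfold_locales (simp_all add: algebra_simps)

definition ideal_gen :: "'a::comm_ring_1 set \<Rightarrow> 'a set" where
  "ideal_gen S = module.span (*) S"

definition ideal_prod :: "'a::comm_ring_1 set \<Rightarrow> 'a set \<Rightarrow> 'a set" where
  "ideal_prod I J = ideal_gen {a * b | a b. a \<in> I \<and> b \<in> J}"

primrec ideal_pow :: "'a::comm_ring_1 set \<Rightarrow> nat \<Rightarrow> 'a set" where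
  "ideal_pow I 0 = UNIV"
| "ideal_pow I (Suc n) = ideal_prod I (ideal_pow I n)"

definition radical_ideal :: "'a::comm_ring_1 set \<Rightarrow> bool" where
  "radical_ideal I \<longleftrightarrow> (\<forall>f n. f ^ n \<in> I \<longrightarrow> f \<in> I)"

text \<open>Each entry is a nonzerodivisor modulo the ideal generated by the preceding ones, and
  together they generate a proper ideal.\<close>
definition regular_sequence :: "'a::comm_ring_1 list \<Rightarrow> bool" where
  "regular_sequence Fs \<longleftrightarrow>
     (\<forall>i<length Fs. \<forall>g. g * Fs ! i \<in> ideal_gen (set (take i Fs)) \<longrightarrow>
        g \<in> ideal_gen (set (take i Fs))) \<and>
     ideal_gen (set Fs) \<noteq> UNIV"

section \<open>The graded ring $k[x_0,x_1,x_2]$\<close>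

text \<open>The variables are indexed by the three-element type \<^typ>\<open>3\<close>; a key of the outer finitely
  supported function is the exponent vector of a monomial, and multiplication is convolution.\<close>
type_synonym 'k poly3 = "(3 \<Rightarrow>\<^sub>0 nat) \<Rightarrow>\<^sub>0 'k"

definition mon_deg :: "(3 \<Rightarrow>\<^sub>0 nat) \<Rightarrow> nat" where
  "mon_deg t = (\<Sum>i\<in>UNIV. Poly_Mapping.lookup t i)"

text \<open>The graded piece of degree \<open>d\<close>, including \<open>0\<close>.\<close>
definition forms :: "nat \<Rightarrow> 'k::comm_ring_1 poly3 set" where
  "forms d = {F. \<forall>t\<in>Poly_Mapping.keys F. mon_deg t = d}"

definition eval3 :: "'k::comm_ring_1 poly3 \<Rightarrow> 'k ^ 3 \<Rightarrow> 'k" where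
  "eval3 F v = 
    (\<Sum>t\<in>Poly_Mapping.keys F. Poly_Mapping.lookup F t *
      (\<Prod>i\<in>UNIV. (v $ i) ^ Poly_Mapping.lookup t i))"

definition pscale :: "'k::comm_ring_1 \<Rightarrow> 'k poly3 \<Rightarrow> 'k poly3" where
  "pscale c F = Poly_Mapping.single 0 c * F"

text \<open>The residue classes of the elements of \<open>B \<subseteq> V\<close> are distinct and form a basis of the image of
  \<open>V\<close> in the quotient by \<open>I\<close>.\<close>
definition quotient_basis ::
    "'k::field poly3 set \<Rightarrow> 'k poly3 set \<Rightarrow> 'k poly3 set \<Rightarrow> bool" where
  "quotient_basis I V B \<longleftrightarrow> finite B \<and> B \<subseteq> V \<and>
     (\<forall>c. (\<Sum>b\<in>B. pscale (c b) b) \<in> I \<longrightarrow> (\<forall>b\<in>B. c b = 0)) \<and>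
     (\<forall>f\<in>V. \<exists>c. f - (\<Sum>b\<in>B. pscale (c b) b) \<in> I)"

text \<open>$\dim_k (R/I)_i$ for a homogeneous ideal \<open>I\<close>, where $(R/I)_i$ is the image of $R_i$ in $R/I$.
  That the description is well defined is shown in \<open>hilbert_function_eq\<close> below.\<close>
definition hilbert_function :: "'k::field poly3 set \<Rightarrow> nat \<Rightarrow> nat" where
  "hilbert_function I i = (THE n. \<exists>B. quotient_basis I (forms i) B \<and> card B = n)"

section \<open>Points of the projective plane and fat point schemes\<close>

text \<open>A point is a line through the origin of $k^3$.\<close>
definition proj_plane :: "('k::field ^ 3) set set" where
  "proj_plane = {L. vec.subspace L \<and> vec.dim L = 1}"

definition point_ideal :: "('k::field ^ 3) set \<Rightarrow> 'k poly3 set" where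
  "point_ideal P = ideal_gen {F. (\<exists>d. F \<in> forms d) \<and> (\<forall>v\<in>P. eval3 F v = 0)}"

definition points_ideal :: "('k::field ^ 3) set set \<Rightarrow> 'k poly3 set" where
  "points_ideal X = (\<Inter>Q\<in>X. point_ideal Q)"

text \<open>A fat point scheme is given by the finite set of its pairs (point, multiplicity), in which
  the points are distinct.\<close>
definition fat_ideal :: "(('k::field ^ 3) set \<times> nat) set \<Rightarrow> 'k poly3 set" where
  "fat_ideal W = (\<Inter>(Q, m)\<in>W. ideal_pow (point_ideal Q) m)"

definition fat_degree :: "(('k::field ^ 3) set \<times> nat) set \<Rightarrow> nat" where
  "fat_degree W = (\<Sum>(Q, m)\<in>W. (m + 1) choose 2)"

definition regularity_index :: "(('k::field ^ 3) set \<times> nat) set \<Rightarrow> nat" where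
  "regularity_index W = (LEAST i. hilbert_function (fat_ideal W) i = fat_degree W)"

definition uniform_fat_points ::
    "('k::field ^ 3) set set \<Rightarrow> nat \<Rightarrow> (('k ^ 3) set \<times> nat) set" where
  "uniform_fat_points X m = (\<lambda>Q. (Q, m)) ` X"

text \<open>Regularity of the sequence forces both forms to be nonzero, so that \<open>F \<in> forms e\<close> does mean
  that \<open>F\<close> has degree \<open>e\<close>.\<close>
definition complete_intersection :: "('k::field ^ 3) set set \<Rightarrow> nat \<Rightarrow> nat \<Rightarrow> bool" where
  "complete_intersection X e1 e2 \<longleftrightarrow>
     X \<subseteq> proj_plane \<and> finite X \<and> card X = e1 * e2 \<and>
     (\<exists>F1 F2. F1 \<in> forms e1 \<and> F2 \<in> forms e2 \<and> regular_sequence [F1, F2] \<and>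
        points_ideal X = ideal_gen {F1, F2} \<and> radical_ideal (ideal_gen {F1, F2}))"

section \<open>The Hilbert function is well defined\<close>

lemma vector_space_pscale: "vector_space (pscale :: 'k::field \<Rightarrow> _)"
  by unfold_locales
    (simp_all only: pscale_def distrib_left distrib_right single_add mult_single add_0
      single_one mult_1 mult.assoc[symmetric])

lemma pscale_eq: "Poly_Mapping.lookup (pscale c F) t = c * Poly_Mapping.lookup F t"
  for F :: "'k::comm_ring_1 poly3"
  by (simp add: pscale_def mult_map_scale_conv_mult[symmetric] Poly_Mapping.map.rep_eq when_def)

lemma finite_mon_deg: "finite {t. mon_deg t = d}"
proof -
  have "Poly_Mapping.lookup ` {t. mon_deg t = d} \<subseteq> (UNIV :: 3 set) \<rightarrow>\<^sub>E {..d}"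
    using member_le_sum[of _ "UNIV :: 3 set"] by (fastforce simp: mon_deg_def)
  moreover have "finite ((UNIV :: 3 set) \<rightarrow>\<^sub>E {..d})"
    by (intro finite_PiE) auto
  ultimately show ?thesis
    by (metis (no_types, lifting) finite_imageD finite_subset inj_onI poly_mapping.lookup_inject)
qed

lemma hilbert_function_eq:
  fixes I :: "'k::field poly3 set"
  assumes "module.subspace (*) I"
  shows "hilbert_function I i =
    vector_space.dim pscale (forms i :: 'k poly3 set) - vector_space.dim pscale (I \<inter> forms i)"
    and "\<exists>B. quotient_basis I (forms i) B"
proof -
  interpret vs: vector_space "pscale :: 'k \<Rightarrow> _"
    by (rule vector_space_pscale)
  interpret ideal: module "(*) :: 'k poly3 \<Rightarrow> _"
    by (rule module_mult)
  let ?V = "forms i :: 'k poly3 set"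
  let ?W = "I \<inter> ?V"
  let ?M = "(\<lambda>t. Poly_Mapping.single t 1) ` {t. mon_deg t = i} :: 'k poly3 set"
  have V: "vs.subspace ?V"
    by (auto simp: vs.subspace_def forms_def in_keys_iff lookup_add pscale_eq)
  have I: "vs.subspace I"
    using assms by (auto simp: vs.subspace_def ideal.subspace_def pscale_def)
  have W: "vs.subspace ?W"
    using V I by (rule vs.subspace_inter[rotated])
  have "?V \<subseteq> vs.span ?M"
  proof
    fix F :: "'k poly3" assume F: "F \<in> ?V"
    have "F = (\<Sum>t\<in>Poly_Mapping.keys F. pscale (Poly_Mapping.lookup F t) (Poly_Mapping.single t 1))"
      by (rule poly_mapping_eqI)
        (auto simp: lookup_sum pscale_eq lookup_single when_def if_distrib in_keys_iff
           cong: if_cong)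
    also have "\<dots> \<in> vs.span ?M"
      using F by (intro vs.span_sum vs.span_scale vs.span_base) (auto simp: forms_def)
    finally show "F \<in> vs.span ?M" .
  qed
  moreover have "finite ?M"
    using finite_mon_deg by simp
  ultimately have fin: "finite B" if "vs.independent B" "B \<subseteq> ?V" for B
    using vs.independent_span_bound[of ?M B] that by blast
  obtain C where C: "C \<subseteq> ?W" "vs.independent C" "vs.span C = ?W" "card C = vs.dim ?W"
    using vs.basis_exists[of ?W] vs.span_minimal[OF _ W] by (metis subset_antisym)
  have finC: "finite C"
    using fin C by blast
  have card: "card B = vs.dim ?V - vs.dim ?W" if B: "quotient_basis I ?V B" for B
  proof -
    have finB: "finite B" and BV: "B \<subseteq> ?V"
      and ind: "\<And>c. (\<Sum>b\<in>B. pscale (c b) b) \<in> I \<Longrightarrow> \<forall>b\<in>B. c b = 0"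
      and spn: "\<And>f. f \<in> ?V \<Longrightarrow> \<exists>c. f - (\<Sum>b\<in>B. pscale (c b) b) \<in> I"
      using B by (auto simp: quotient_basis_def)
    have disj: "B \<inter> C = {}"
    proof (rule ccontr)
      assume "B \<inter> C \<noteq> {}"
      then obtain b where b: "b \<in> B" "b \<in> C" by blast
      have "(\<Sum>x\<in>B. pscale (if x = b then 1 else 0) x) = b"
        using finB b by (subst sum.remove[OF finB b(1)]) simp
      then show False
        using ind[of "\<lambda>x. if x = b then 1 else 0", THEN bspec, OF _ b(1)] b C by auto
    qed
    have "vs.independent (B \<union> C)"
    proof (rule vs.independent_if_scalars_zero)
      fix f x
      assume s: "(\<Sum>x\<in>B \<union> C. pscale (f x) x) = 0" and x: "x \<in> B \<union> C"
      have s': "(\<Sum>x\<in>B. pscale (f x) x) + (\<Sum>x\<in>C. pscale (f x) x) = 0"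
        using s by (simp add: sum.union_disjoint finB finC disj)
      have "- (\<Sum>x\<in>C. pscale (f x) x) \<in> I"
        using C by (intro vs.subspace_neg vs.subspace_sum vs.subspace_scale I) auto
      then have "(\<Sum>x\<in>B. pscale (f x) x) \<in> I"
        using s' by (simp add: eq_neg_iff_add_eq_0[symmetric])
      then have fB: "\<forall>b\<in>B. f b = 0" by (rule ind)
      then have "(\<Sum>x\<in>C. pscale (f x) x) = 0"
        using s' by simp
      then have "\<forall>x\<in>C. f x = 0"
        using C(2) finC by (auto simp: vs.dependent_finite)
      then show "f x = 0" using fB x by blast
    qed (use finB finC in auto)
    moreover have "?V \<subseteq> vs.span (B \<union> C)"
    proof
      fix f assume f: "f \<in> ?V"
      then obtain c where c: "f - (\<Sum>b\<in>B. pscale (c b) b) \<in> I" using spn by blast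
      have "f - (\<Sum>b\<in>B. pscale (c b) b) \<in> ?V"
        using f BV by (intro vs.subspace_diff vs.subspace_sum vs.subspace_scale V) auto
      with c C(3) have "f - (\<Sum>b\<in>B. pscale (c b) b) \<in> vs.span (B \<union> C)"
        using vs.span_mono[of C "B \<union> C"] by auto
      moreover have "(\<Sum>b\<in>B. pscale (c b) b) \<in> vs.span (B \<union> C)"
        by (intro vs.span_sum vs.span_scale vs.span_base) auto
      ultimately show "f \<in> vs.span (B \<union> C)"
        using vs.span_add by fastforce
    qed
    moreover have "B \<union> C \<subseteq> ?V" using BV C by auto
    ultimately have "card (B \<union> C) = vs.dim ?V"
      by (intro vs.basis_card_eq_dim)
    then show ?thesis
      using C(4) by (simp add: card_Un_disjoint finB finC disj)
  qed
  obtain D where D: "C \<subseteq> D" "D \<subseteq> ?V" "vs.independent D" "?V \<subseteq> vs.span D"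
    using vs.maximal_independent_subset_extend[of C ?V] C by blast
  have finD: "finite D" using fin D by blast
  have "quotient_basis I ?V (D - C)"
    unfolding quotient_basis_def
  proof (intro conjI allI impI ballI)
    show "finite (D - C)" "D - C \<subseteq> ?V" using finD D by auto
  next
    fix c b assume c: "(\<Sum>b\<in>D - C. pscale (c b) b) \<in> I" and b: "b \<in> D - C"
    have "(\<Sum>b\<in>D - C. pscale (c b) b) \<in> ?V"
      using D by (intro vs.subspace_sum vs.subspace_scale V) auto
    with c have "(\<Sum>b\<in>D - C. pscale (c b) b) \<in> vs.span C" using C by auto
    then obtain u where u: "(\<Sum>b\<in>D - C. pscale (c b) b) = (\<Sum>x\<in>C. pscale (u x) x)"
      by (auto simp: vs.span_finite[OF finC])
    define w where "w x = (if x \<in> C then - u x else c x)" for x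
    have "(\<Sum>x\<in>D. pscale (w x) x) = (\<Sum>x\<in>D - C. pscale (w x) x) + (\<Sum>x\<in>C. pscale (w x) x)"
      by (rule sum.subset_diff[OF D(1) finD])
    also have "\<dots> = 0"
      using u by (simp add: w_def sum_negf)
    finally have "\<forall>x\<in>D. w x = 0"
      using D(3) finD by (auto simp: vs.dependent_finite)
    then show "c b = 0" using b by (auto simp: w_def)
  next
    fix f assume "f \<in> ?V"
    then obtain u where "f = (\<Sum>x\<in>D. pscale (u x) x)"
      using D(4) by (auto simp: vs.span_finite[OF finD])
    then have "f - (\<Sum>b\<in>D - C. pscale (u b) b) = (\<Sum>x\<in>C. pscale (u x) x)"
      by (simp add: sum.subset_diff[OF D(1) finD])
    also have "\<dots> \<in> I"
      using C by (intro vs.subspace_sum vs.subspace_scale I) auto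
    finally show "\<exists>c. f - (\<Sum>b\<in>D - C. pscale (c b) b) \<in> I" by blast
  qed
  then show ex: "\<exists>B. quotient_basis I ?V B" by blast
  show "hilbert_function I i = vs.dim ?V - vs.dim ?W"
    unfolding hilbert_function_def using ex card by (intro the_equality) auto
qed

end

theory Submission
  imports Defs
begin

text \<open>Let \<open>(F, G)\<close> be the ideal of \<open>X\<close>. By the Cayley-Bacharach theorem the points of
  \<open>X - {P}\<close> have separators \<open>H\<close> of degree \<open>d\<^sub>1 + d\<^sub>2 - 3\<close>; as \<open>F\<close> and \<open>G\<close> are local
  parameters at each point, the products \<open>F\<^sup>x G\<^sup>y H\<close> with \<open>x + y < m\<close>, filled up to degree
  \<open>t = d\<^sub>1 + m d\<^sub>2 - 3\<close>, show that \<open>Y\<close> imposes independent conditions in degree \<open>t\<close>.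
  Conversely \<open>Y\<close> contains the \<open>m\<close>-fold points on \<open>X\<^sub>1\<close>, which contain
  (schematically) a complete intersection of type \<open>(d\<^sub>1 - 1, m d\<^sub>2)\<close>, whose Hilbert function is not
  yet maximal in degrees below \<open>t\<close>.\<close>

section \<open>Dimension counts in a graded piece\<close>

text \<open>The degree \<open>t\<close> is where two estimates meet. A separator times
  \<open>F^x G^y\<close> with \<open>x + y < m\<close> has degree at most
  \<open>(m - 1) d2 + (d1 + d2 - 3) = t\<close>, the extreme case being \<open>G^(m-1)\<close>
  because \<open>d1 \<le> d2\<close>. A complete intersection of type \<open>(e1, e2)\<close>
  attains its degree first at \<open>e1 + e2 - 2\<close>, which is again \<open>t\<close> for
  \<open>(d1 - 1, m d2)\<close>. Taking \<open>P\<close> in \<open>X2\<close> keeps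
  \<open>X1\<close> whole, so the second estimate survives the removal.

  Local rings never appear. Upper bounds on a Hilbert function are spanning sets of a graded piece
  modulo the ideal, lower bounds are families independent modulo it. Order of vanishing is read off
  by restricting forms to lines \<open>q + s v\<close>, and lines along which \<open>F\<close> and
  \<open>G\<close> have prescribed derivatives play the part of local coordinates. Since an
  \<open>m\<close>-fold point imposes at most \<open>(m + 1) choose 2\<close> conditions, a deficit
  on \<open>X1\<close> cannot be made up by the remaining points.\<close>

interpretation pv: vector_space "pscale :: 'k::field \<Rightarrow> 'k poly3 \<Rightarrow> 'k poly3"
  by (rule vector_space_pscale)

interpretation rm: module "(*) :: 'a::comm_ring_1 \<Rightarrow> 'a \<Rightarrow> 'a"
  by (rule module_mult)

declare rm.scale_scale [simp del] \<comment> \<open>loops with \<open>mult.assoc\<close>\<close>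

definition mons :: "nat \<Rightarrow> (3 \<Rightarrow>\<^sub>0 nat) set" where
  "mons d = {t. mon_deg t = d}"

lemma finite_mons [simp]: "finite (mons d)"
  by (simp add: mons_def finite_mon_deg)

lemma poly3_expand:
  fixes F :: "'k::comm_ring_1 poly3"
  shows "F = (\<Sum>t\<in>Poly_Mapping.keys F.
    pscale (Poly_Mapping.lookup F t) (Poly_Mapping.single t 1))"
  by (rule poly_mapping_eqI)
    (auto simp: lookup_sum pscale_eq lookup_single when_def if_distrib in_keys_iff cong: if_cong)

lemma subspace_forms: "pv.subspace (forms d :: 'k::field poly3 set)"
  by (auto simp: pv.subspace_def forms_def in_keys_iff lookup_add pscale_eq)

lemma form_expand:
  fixes F :: "'k::field poly3"
  assumes "F \<in> forms d"
  shows "F = (\<Sum>t\<in>mons d. pscale (Poly_Mapping.lookup F t) (Poly_Mapping.single t 1))"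
proof -
  have "(\<Sum>t\<in>Poly_Mapping.keys F. pscale (Poly_Mapping.lookup F t) (Poly_Mapping.single t 1)) =
    (\<Sum>t\<in>mons d. pscale (Poly_Mapping.lookup F t) (Poly_Mapping.single t 1))"
    by (rule sum.mono_neutral_left)
      (use assms in \<open>auto simp: forms_def mons_def in_keys_iff finite_mon_deg\<close>)
  with poly3_expand[of F] show ?thesis by (rule trans)
qed

lemma single_in_forms: "t \<in> mons d \<Longrightarrow> Poly_Mapping.single t c \<in> forms d"
  by (auto simp: forms_def mons_def split: if_splits)

lemma subspace_ideal:
  assumes "rm.subspace (I :: 'k::field poly3 set)"
  shows "pv.subspace I"
  using assms by (auto simp: pv.subspace_def rm.subspace_def pscale_def)

lemma subspace_ideal_forms:
  assumes "rm.subspace (I :: 'k::field poly3 set)"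
  shows "pv.subspace (I \<inter> forms d)"
  by (intro pv.subspace_inter subspace_ideal subspace_forms assms)

lemma forms_subset_span:
  "(forms d :: 'k::field poly3 set) \<subseteq> pv.span ((\<lambda>t. Poly_Mapping.single t 1) ` mons d)"
proof
  fix F :: "'k poly3" assume "F \<in> forms d"
  then show "F \<in> pv.span ((\<lambda>t. Poly_Mapping.single t 1) ` mons d)"
    by (subst form_expand[of F d], assumption, intro pv.span_sum pv.span_scale pv.span_base)
      simp
qed

lemma finite_independent_forms:
  assumes "pv.independent (B :: 'k::field poly3 set)" "B \<subseteq> forms d"
  shows "finite B"
  using pv.independent_span_bound[of "(\<lambda>t. Poly_Mapping.single t 1) ` mons d" B]
    order_trans[OF assms(2) forms_subset_span] assms(1) by simp

lemma obtain_basis: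
  assumes "pv.subspace (U :: 'k::field poly3 set)" "U \<subseteq> forms d"
  obtains C where "C \<subseteq> U" "pv.independent C" "pv.span C = U" "card C = pv.dim U" "finite C"
proof -
  obtain C where "C \<subseteq> U" "pv.independent C" "pv.span C = U" "card C = pv.dim U"
    using pv.basis_exists[of U] pv.span_minimal[OF _ assms(1)] by (metis subset_antisym)
  with finite_independent_forms[of C d] assms that show ?thesis by blast
qed

lemma card_independent_le_dim:
  assumes "pv.subspace (V :: 'k::field poly3 set)" "V \<subseteq> forms d"
    and "pv.independent B" "B \<subseteq> V"
  shows "card B \<le> pv.dim V"
proof -
  obtain C where C: "C \<subseteq> V" "pv.independent C" "pv.span C = V" "card C = pv.dim V" "finite C"
    using obtain_basis[OF assms(1,2)] .
  show ?thesis
    using pv.independent_span_bound[of C B] C assms by simp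
qed

lemma dim_span_Un:
  fixes V U B :: "'k::field poly3 set"
  assumes "pv.subspace U" "U \<subseteq> forms d" "finite B" "V \<subseteq> pv.span (B \<union> U)"
  shows "pv.dim V \<le> card B + pv.dim U"
proof -
  obtain C where C: "C \<subseteq> U" "pv.independent C" "pv.span C = U" "card C = pv.dim U" "finite C"
    using obtain_basis[OF assms(1,2)] .
  have "B \<union> U \<subseteq> pv.span (B \<union> C)"
    using pv.span_mono[of C "B \<union> C"] pv.span_superset[of "B \<union> C"] C(3) by simp
  then have "V \<subseteq> pv.span (B \<union> C)"
    by (rule order_trans[OF assms(4) pv.span_minimal[OF _ pv.subspace_span]])
  then have "pv.dim V \<le> card (B \<union> C)"
    by (rule pv.dim_le_card) (simp add: assms(3) C(5))
  then show ?thesis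
    using card_Un_le[of B C] C by linarith
qed

text \<open>Independence modulo \<open>U\<close> already forces \<open>f\<close> to be injective and
  its values to stay outside a basis of \<open>U\<close>, so the values and that basis are jointly
  independent in \<open>V\<close>. An indexed family suits the later uses, whose indices are
  monomials or triples (point, exponent, exponent).\<close>

lemma indep_family_dim:
  fixes f :: "'i \<Rightarrow> 'k::field poly3"
  assumes U: "pv.subspace U" "U \<subseteq> V" and V: "pv.subspace V" "V \<subseteq> forms d"
    and T: "finite T" "\<And>i. i \<in> T \<Longrightarrow> f i \<in> V"
    and ind: "\<And>c. (\<Sum>i\<in>T. pscale (c i) (f i)) \<in> U \<Longrightarrow> \<forall>i\<in>T. c i = 0"
  shows "card T + pv.dim U \<le> pv.dim V"
proof -
  obtain C where C: "C \<subseteq> U" "pv.independent C" "pv.span C = U" "card C = pv.dim U" "finite C"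
    using obtain_basis[OF U(1) order_trans[OF U(2) V(2)]] .
  have 0: "0 \<in> U" using U(1) by (rule pv.subspace_0)
  have inj: "inj_on f T"
  proof (rule inj_onI, rule ccontr)
    fix i j assume ij: "i \<in> T" "j \<in> T" "f i = f j" "i \<noteq> j"
    define c :: "'i \<Rightarrow> 'k" where "c x = (if x = i then 1 else if x = j then -1 else 0)" for x
    have "(\<Sum>x\<in>T. pscale (c x) (f x)) = (\<Sum>x\<in>{i,j}. pscale (c x) (f x))"
      by (rule sum.mono_neutral_right) (use ij T in \<open>auto simp: c_def\<close>)
    also have "\<dots> = 0" using ij by (simp add: c_def)
    finally have "c i = 0" using ind[of c] ij 0 by simp
    then show False by (simp add: c_def)
  qed
  have disj: "f ` T \<inter> C = {}"
  proof (rule ccontr)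
    assume "f ` T \<inter> C \<noteq> {}"
    then obtain i where i: "i \<in> T" "f i \<in> C" by blast
    have "(\<Sum>x\<in>T. pscale (if x = i then 1 else 0) (f x)) = f i"
      using T i by (subst sum.remove[OF T(1) i(1)]) simp
    then show False
      using ind[of "\<lambda>x. if x = i then 1 else 0", THEN bspec, OF _ i(1)] i C by auto
  qed
  have "pv.independent (f ` T \<union> C)"
  proof (rule pv.independent_if_scalars_zero)
    fix g x
    assume s: "(\<Sum>x\<in>f ` T \<union> C. pscale (g x) x) = 0" and x: "x \<in> f ` T \<union> C"
    have s': "(\<Sum>i\<in>T. pscale (g (f i)) (f i)) + (\<Sum>x\<in>C. pscale (g x) x) = 0"
      using s by (simp add: sum.union_disjoint T C disj sum.reindex[OF inj])
    have "- (\<Sum>x\<in>C. pscale (g x) x) \<in> U"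
      using C by (intro pv.subspace_neg pv.subspace_sum pv.subspace_scale U) auto
    then have "(\<Sum>i\<in>T. pscale (g (f i)) (f i)) \<in> U"
      using s' by (simp add: eq_neg_iff_add_eq_0[symmetric])
    then have gT: "\<forall>i\<in>T. g (f i) = 0" by (rule ind)
    then have "(\<Sum>x\<in>C. pscale (g x) x) = 0"
      using s' by simp
    then have "\<forall>x\<in>C. g x = 0"
      using C(2,5) by (auto simp: pv.dependent_finite)
    then show "g x = 0" using gT x by blast
  qed (use T C(5) in auto)
  then have "card (f ` T \<union> C) \<le> pv.dim V"
    by (rule card_independent_le_dim[OF V]) (use T(2) C(1) U(2) in blast)
  then show ?thesis
    by (simp add: card_Un_disjoint T C(4,5) disj card_image[OF inj])
qed

lemma obtain_complement:
  assumes U: "pv.subspace (U :: 'k::field poly3 set)" "U \<subseteq> V"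
    and V: "pv.subspace V" "V \<subseteq> forms d"
  obtains E where "finite E" "E \<subseteq> V" "card E + pv.dim U = pv.dim V" "V \<subseteq> pv.span (E \<union> U)"
    "\<And>c. (\<Sum>e\<in>E. pscale (c e) e) \<in> U \<Longrightarrow> \<forall>e\<in>E. c e = 0"
proof -
  obtain C where C: "C \<subseteq> U" "pv.independent C" "pv.span C = U" "card C = pv.dim U" "finite C"
    using obtain_basis[OF U(1) order_trans[OF U(2) V(2)]] .
  obtain D where D: "C \<subseteq> D" "D \<subseteq> V" "pv.independent D" "V \<subseteq> pv.span D"
    using pv.maximal_independent_subset_extend[of C V] C U by blast
  have finD: "finite D" using finite_independent_forms D V by blast
  have cD: "card D = pv.dim V" using D by (intro pv.basis_card_eq_dim)
  show ?thesis
  proof (rule that[of "D - C"])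
    show "finite (D - C)" "D - C \<subseteq> V" using finD D by auto
    show "card (D - C) + pv.dim U = pv.dim V"
      using C D finD cD card_mono[OF finD D(1)] by (simp add: card_Diff_subset)
    have "D \<subseteq> (D - C) \<union> U" using C by auto
    then show "V \<subseteq> pv.span ((D - C) \<union> U)" using D(4) pv.span_mono by blast
    fix c assume c: "(\<Sum>b\<in>D - C. pscale (c b) b) \<in> U"
    then obtain u where u: "(\<Sum>b\<in>D - C. pscale (c b) b) = (\<Sum>x\<in>C. pscale (u x) x)"
      using C(3) by (auto simp: pv.span_finite[OF C(5)])
    define w where "w x = (if x \<in> C then - u x else c x)" for x
    have "(\<Sum>x\<in>D. pscale (w x) x) = (\<Sum>x\<in>D - C. pscale (w x) x) + (\<Sum>x\<in>C. pscale (w x) x)"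
      by (rule sum.subset_diff[OF D(1) finD])
    also have "\<dots> = 0"
      using u by (simp add: w_def sum_negf)
    finally have "\<forall>x\<in>D. w x = 0"
      using D(3) finD by (auto simp: pv.dependent_finite)
    then show "\<forall>b\<in>D - C. c b = 0" by (auto simp: w_def)
  qed
qed

lemma dim_subspace_mono:
  assumes "pv.subspace (U :: 'k::field poly3 set)" "U \<subseteq> V" "pv.subspace V" "V \<subseteq> forms d"
  shows "pv.dim U \<le> pv.dim V"
  by (rule obtain_complement[OF assms]) simp

text \<open>Monotonicity of dimension makes the truncated subtraction in
  \<open>hilbert_function_eq\<close> an honest one.\<close>

lemma hilbert_add_dim:
  fixes I :: "'k::field poly3 set"
  assumes "rm.subspace I"
  shows "hilbert_function I d + pv.dim (I \<inter> forms d) = pv.dim (forms d :: 'k poly3 set)"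
  using hilbert_function_eq(1)[OF assms, of d]
    dim_subspace_mono[OF subspace_ideal_forms[OF assms, of d] Int_lower2 subspace_forms order_refl]
  by simp

lemma hilbert_span:
  fixes I :: "'k::field poly3 set"
  assumes "rm.subspace I"
  obtains B where "finite B" "B \<subseteq> forms d" "card B = hilbert_function I d"
    "forms d \<subseteq> pv.span (B \<union> (I \<inter> forms d))"
  by (rule obtain_complement[OF subspace_ideal_forms[OF assms, of d] Int_lower2 subspace_forms
      order_refl])
    (use hilbert_add_dim[OF assms, of d] in \<open>auto intro!: that\<close>)

lemma hilbert_le:
  fixes I :: "'k::field poly3 set"
  assumes "rm.subspace I" "finite B" "forms d \<subseteq> pv.span (B \<union> (I \<inter> forms d))"
  shows "hilbert_function I d \<le> card B"
  using dim_span_Un[OF subspace_ideal_forms[OF assms(1), of d] Int_lower2 assms(2,3)]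
    hilbert_add_dim[OF assms(1), of d] by simp

lemma hilbert_ge:
  fixes I :: "'k::field poly3 set" and f :: "'i \<Rightarrow> 'k poly3"
  assumes "rm.subspace I" "finite T" "\<And>i. i \<in> T \<Longrightarrow> f i \<in> forms d"
    and "\<And>c. (\<Sum>i\<in>T. pscale (c i) (f i)) \<in> I \<Longrightarrow> \<forall>i\<in>T. c i = 0"
  shows "card T \<le> hilbert_function I d"
proof -
  have "card T + pv.dim (I \<inter> forms d) \<le> pv.dim (forms d :: 'k poly3 set)"
    by (rule indep_family_dim[OF subspace_ideal_forms[OF assms(1), of d] Int_lower2 subspace_forms
      order_refl assms(2,3)]) (use assms(4) in auto)
  then show ?thesis using hilbert_add_dim[OF assms(1), of d] by simp
qed

lemma hilbert_antimono:
  fixes I J :: "'k::field poly3 set"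
  assumes "rm.subspace I" "rm.subspace J" "I \<inter> forms d \<subseteq> J"
  shows "hilbert_function J d \<le> hilbert_function I d"
proof -
  have "pv.dim (I \<inter> forms d) \<le> pv.dim (J \<inter> forms d)"
    by (rule dim_subspace_mono[OF subspace_ideal_forms[OF assms(1)] _ subspace_ideal_forms[OF assms(2)]])
      (use assms in auto)
  then show ?thesis
    using hilbert_add_dim[OF assms(1), of d] hilbert_add_dim[OF assms(2), of d] by simp
qed

text \<open>The quotient of \<open>J\<close> by \<open>I \<inter> J\<close> embeds into the quotient
  of the whole ring by \<open>I\<close>; the set \<open>E\<close> is a basis of the former in degree
  \<open>d\<close>.\<close>

lemma hilbert_Int:
  fixes I J :: "'k::field poly3 set"
  assumes "rm.subspace I" "rm.subspace J"
  shows "hilbert_function (I \<inter> J) d \<le> hilbert_function I d + hilbert_function J d"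
proof -
  have IJ: "rm.subspace (I \<inter> J)" using assms by (rule rm.subspace_inter)
  obtain E where E: "finite E" "E \<subseteq> J \<inter> forms d"
    "card E + pv.dim ((I \<inter> J) \<inter> forms d) = pv.dim (J \<inter> forms d)"
    "\<And>c. (\<Sum>e\<in>E. pscale (c e) e) \<in> (I \<inter> J) \<inter> forms d \<Longrightarrow> \<forall>e\<in>E. c e = 0"
    by (rule obtain_complement[OF subspace_ideal_forms[OF IJ, of d] _
          subspace_ideal_forms[OF assms(2), of d] Int_lower2]) auto
  have "card E \<le> hilbert_function I d"
  proof (rule hilbert_ge[OF assms(1) E(1), where f = "\<lambda>e. e"])
    fix c assume c: "(\<Sum>e\<in>E. pscale (c e) e) \<in> I"
    have "(\<Sum>e\<in>E. pscale (c e) e) \<in> J \<inter> forms d"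
      using E(2) by (intro pv.subspace_sum pv.subspace_scale subspace_ideal_forms assms) auto
    with c E(4) show "\<forall>e\<in>E. c e = 0" by blast
  qed (use E in auto)
  then show ?thesis
    using E(3) hilbert_add_dim[OF assms(2), of d] hilbert_add_dim[OF IJ, of d] by simp
qed

lemma hilbert_UNIV: "hilbert_function (UNIV :: 'k::field poly3 set) d = 0"
  using hilbert_add_dim[OF rm.subspace_UNIV, of d] by (simp add: Int_absorb1)

lemma hilbert_INT:
  fixes I :: "'i \<Rightarrow> 'k::field poly3 set"
  assumes "finite S" "\<And>Q. Q \<in> S \<Longrightarrow> rm.subspace (I Q)"
    "\<And>Q. Q \<in> S \<Longrightarrow> hilbert_function (I Q) d \<le> n"
  shows "hilbert_function (\<Inter>Q\<in>S. I Q) d \<le> card S * n"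
  using assms
proof (induction S)
  case empty
  then show ?case by (simp add: hilbert_UNIV)
next
  case (insert Q S)
  have "rm.subspace (\<Inter>Q\<in>S. I Q)"
    using insert by (intro rm.subspace_Inter) auto
  then have "hilbert_function (I Q \<inter> (\<Inter>Q\<in>S. I Q)) d \<le> n + card S * n"
    using insert by (intro order_trans[OF hilbert_Int] add_mono) auto
  then show ?case using insert by simp
qed

section \<open>Forms, substitution of a line, and powers of point ideals\<close>

lemma forms_mult:
  fixes F G :: "'k::comm_ring_1 poly3"
  assumes "F \<in> forms d" "G \<in> forms e"
  shows "F * G \<in> forms (d + e)"
proof -
  have "mon_deg (s + t) = mon_deg s + mon_deg t" for s t
    by (simp add: mon_deg_def lookup_add sum.distrib)
  then show ?thesis
    using assms keys_mult[of F G] by (fastforce simp: forms_def)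
qed

lemma one_in_forms: "(1 :: 'k::comm_ring_1 poly3) \<in> forms 0"
  by (simp add: forms_def mon_deg_def)

lemma forms_power: "F \<in> forms d \<Longrightarrow> F ^ n \<in> forms (n * d)" for F :: "'k::comm_ring_1 poly3"
proof (induction n)
  case (Suc n)
  then show ?case using forms_mult[of F d "F ^ n" "n * d"] by simp
qed (simp add: one_in_forms)

lemma pscale_mult_left: "pscale c (F * G) = pscale c F * G"
  and pscale_mult_right: "pscale c (F * G) = F * pscale c G"
  for F G :: "'k::comm_ring_1 poly3"
  by (simp_all only: pscale_def mult.assoc mult.left_commute[of F])

lemma mult_span:
  fixes F :: "'k::field poly3"
  assumes "G \<in> pv.span S"
  shows "F * G \<in> pv.span ((*) F ` S)"
  using assms
proof (induction rule: pv.span_induct_alt)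
  case base
  show ?case by (simp add: pv.span_zero)
next
  case (step c x y)
  have "F * (pscale c x + y) = pscale c (F * x) + F * y"
    by (simp add: distrib_left pscale_mult_right)
  also have "\<dots> \<in> pv.span ((*) F ` S)"
    by (intro pv.span_add pv.span_scale pv.span_base imageI step)
  finally show ?case .
qed

section \<open>The variables, and restriction to a line as a ring homomorphism\<close>

definition var :: "3 \<Rightarrow> 'k::comm_ring_1 poly3" where
  "var i = Poly_Mapping.single (Poly_Mapping.single i 1) 1"

lemma var_in_forms: "var i \<in> forms 1"
  by (auto simp: var_def forms_def mon_deg_def lookup_single when_def)

lemma var_power: "var i ^ n = Poly_Mapping.single (Poly_Mapping.single i n) 1"
  by (induction n) (auto simp: var_def mult_single single_add[symmetric])

text \<open>The trailing factor \<open>1\<close> is the element from which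
  \<open>fspan_var_power\<close> later builds the monomial by three multiplications.\<close>

lemma single_eq_vars:
  "Poly_Mapping.single t 1 =
    (var 1 ^ Poly_Mapping.lookup t 1 * (var 2 ^ Poly_Mapping.lookup t 2 *
      (var 3 ^ Poly_Mapping.lookup t 3 * 1)) :: 'k::comm_ring_1 poly3)"
proof -
  define u :: "3 \<Rightarrow>\<^sub>0 nat" where "u = Poly_Mapping.single 1 (Poly_Mapping.lookup t 1) +
        (Poly_Mapping.single 2 (Poly_Mapping.lookup t 2) +
         Poly_Mapping.single 3 (Poly_Mapping.lookup t 3))"
  have "t = u"
  proof (rule poly_mapping_eqI)
    fix i
    show "Poly_Mapping.lookup t i = Poly_Mapping.lookup u i"
      using exhaust_3[of i] by (elim disjE) (simp_all add: u_def lookup_add lookup_single when_def)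
  qed
  then have "Poly_Mapping.single t 1 = (Poly_Mapping.single u 1 :: 'k poly3)"
    by (rule arg_cong)
  also have "\<dots> = var 1 ^ Poly_Mapping.lookup t 1 * (var 2 ^ Poly_Mapping.lookup t 2 *
      (var 3 ^ Poly_Mapping.lookup t 3 * 1))"
    by (simp add: var_power mult_single u_def)
  finally show ?thesis .
qed

text \<open>The restriction of \<open>F\<close> to the parametrised line \<open>q + s v\<close>, as a polynomial in \<open>s\<close>.\<close>
definition psub :: "'k::comm_ring_1 ^ 3 \<Rightarrow> 'k ^ 3 \<Rightarrow> 'k poly3 \<Rightarrow> 'k poly" where
  "psub q v F = (\<Sum>t\<in>Poly_Mapping.keys F. smult (Poly_Mapping.lookup F t)
     (\<Prod>i\<in>UNIV. [:q $ i, v $ i:] ^ Poly_Mapping.lookup t i))"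

lemma psub_add: "psub q v (F + G) = psub q v F + psub q v G"
  unfolding psub_def by (rule setsum_keys_plus_distrib) (simp_all add: smult_add_left)

lemma psub_0 [simp]: "psub q v 0 = 0"
  by (simp add: psub_def)

lemma psub_1 [simp]: "psub q v 1 = 1"
  by (simp add: psub_def)

lemma psub_sum: "psub q v (\<Sum>i\<in>S. f i) = (\<Sum>i\<in>S. psub q v (f i))"
  by (induction S rule: infinite_finite_induct) (simp_all add: psub_add)

lemma psub_single: "psub q v (Poly_Mapping.single t c) =
    smult c (\<Prod>i\<in>UNIV. [:q $ i, v $ i:] ^ Poly_Mapping.lookup t i)"
  by (cases "c = 0") (simp_all add: psub_def)

lemma psub_mult: "psub q v (F * G) = psub q v F * psub q v G"
  for F G :: "'k::comm_ring_1 poly3"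
proof -
  have ex: "F = (\<Sum>t\<in>Poly_Mapping.keys F. Poly_Mapping.single t (Poly_Mapping.lookup F t))"
    for F :: "'k poly3"
    by (rule poly_mapping_eqI) (auto simp: lookup_sum lookup_single when_def in_keys_iff)
  have "F * G = (\<Sum>s\<in>Poly_Mapping.keys F. \<Sum>t\<in>Poly_Mapping.keys G.
      Poly_Mapping.single (s + t) (Poly_Mapping.lookup F s * Poly_Mapping.lookup G t))"
    by (subst ex[of F], subst ex[of G]) (simp add: sum_product mult_single)
  then have "psub q v (F * G) = (\<Sum>s\<in>Poly_Mapping.keys F. \<Sum>t\<in>Poly_Mapping.keys G.
      psub q v (Poly_Mapping.single (s + t) (Poly_Mapping.lookup F s * Poly_Mapping.lookup G t)))"
    by (simp only: psub_sum)
  also have "\<dots> = psub q v F * psub q v G"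
    unfolding psub_single
    by (simp add: psub_def sum_product lookup_add power_add prod.distrib mult.commute)
  finally show ?thesis .
qed

lemma psub_power: "psub q v (F ^ n) = psub q v F ^ n"
  by (induction n) (simp_all add: psub_mult)

lemma psub_pscale: "psub q v (pscale c F) = smult c (psub q v F)"
  by (simp add: pscale_def psub_mult psub_single)

lemma psub_minus: "psub q v (- F) = - psub q v F"
  using psub_add[of q v F "- F"] by (simp add: add_eq_0_iff)

lemma psub_diff: "psub q v (F - G) = psub q v F - psub q v G"
  using psub_add[of q v F "- G"] by (simp add: psub_minus)

lemma psub_var: "psub q v (var i) = [:q $ i, v $ i:]"
proof -
  have "(\<Prod>j\<in>UNIV. [:q $ j, v $ j:] ^ Poly_Mapping.lookup (Poly_Mapping.single i 1) j) =
      (\<Prod>j\<in>UNIV. if j = i then [:q $ j, v $ j:] else 1)"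
    by (rule prod.cong) (simp_all add: lookup_single when_def)
  then show ?thesis by (simp add: var_def psub_single)
qed

lemma coeff_0_psub: "coeff (psub q v F) 0 = eval3 F q"
proof -
  have "poly (psub q v F) 0 = eval3 F q"
    by (simp add: psub_def eval3_def poly_prod poly_sum)
  then show ?thesis by (simp only: poly_0_coeff_0)
qed

text \<open>Evaluation is the constant term of the restriction to any line through \<open>q\<close>,
  so these laws are inherited from \<open>psub\<close>; the direction, here \<open>q\<close> itself,
  is arbitrary.\<close>

lemma eval3_mult: "eval3 (F * G) q = eval3 F q * eval3 G q"
  and eval3_add: "eval3 (F + G) q = eval3 F q + eval3 G q"
  and eval3_power: "eval3 (F ^ n) q = eval3 F q ^ n"
  and eval3_0 [simp]: "eval3 0 q = 0"
  using psub_mult[of q q F G] psub_add[of q q F G] psub_power[of q q F n]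
  by (simp_all add: coeff_0_psub[of q q, symmetric] coeff_mult_0 coeff_0_power)

lemma eval3_homogeneous:
  assumes "F \<in> forms d"
  shows "eval3 F (c *s q) = c ^ d * eval3 F q"
proof -
  have "(\<Prod>i\<in>UNIV. (c * q $ i) ^ Poly_Mapping.lookup t i) =
      c ^ d * (\<Prod>i\<in>UNIV. (q $ i) ^ Poly_Mapping.lookup t i)" if "t \<in> Poly_Mapping.keys F" for t
  proof -
    have "d = (\<Sum>i\<in>UNIV. Poly_Mapping.lookup t i)"
      using assms that by (auto simp: forms_def mon_deg_def)
    then have "c ^ d = (\<Prod>i\<in>UNIV. c ^ Poly_Mapping.lookup t i)"
      by (simp only: power_sum)
    then show ?thesis
      by (simp only: power_mult_distrib prod.distrib)
  qed
  then have "eval3 F (c *s q) = (\<Sum>t\<in>Poly_Mapping.keys F. Poly_Mapping.lookup F t *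
      (c ^ d * (\<Prod>i\<in>UNIV. (q $ i) ^ Poly_Mapping.lookup t i)))"
    by (simp add: eval3_def)
  also have "\<dots> = c ^ d * eval3 F q"
    unfolding eval3_def sum_distrib_left by (rule sum.cong) (simp_all only: mult.left_commute)
  finally show ?thesis .
qed

section \<open>Points, their ideals and the powers of these\<close>

lemma obtain_rep:
  assumes "Q \<in> proj_plane"
  obtains q where "q \<noteq> 0" "Q = vec.span {q}" "q \<in> Q"
proof -
  have Q: "vec.subspace Q" "vec.dim Q = 1"
    using assms by (auto simp: proj_plane_def)
  obtain B where B: "B \<subseteq> Q" "vec.independent B" "Q \<subseteq> vec.span B" "card B = 1"
    using vec.basis_exists[of Q] Q(2) by metis
  obtain q where q: "B = {q}" using B(4) by (auto simp: card_1_singleton_iff)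
  have "Q = vec.span {q}" using B(1,3) vec.span_minimal[OF B(1) Q(1)] by (auto simp: q)
  moreover have "q \<noteq> 0" using B(2) q vec.dependent_zero by blast
  ultimately show ?thesis using that B(1) q by blast
qed

lemma eval3_point_ideal: "F \<in> point_ideal Q \<Longrightarrow> q \<in> Q \<Longrightarrow> eval3 F q = 0"
  unfolding point_ideal_def ideal_gen_def
  by (induction F rule: rm.span_induct_alt) (auto simp: eval3_add eval3_mult)

text \<open>By homogeneity, vanishing at one representative is vanishing on the whole line that
  constitutes the point.\<close>

lemma form_in_point_ideal:
  assumes "F \<in> forms d" "eval3 F q = 0"
  shows "F \<in> point_ideal (vec.span {q})"
  unfolding point_ideal_def ideal_gen_def
  by (rule rm.span_base) (use assms in \<open>auto simp: vec.span_singleton eval3_homogeneous\<close>)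

lemma ideal_gen_ideal: "rm.subspace (ideal_gen S)"
  by (simp add: ideal_gen_def rm.subspace_span)

lemma point_ideal_ideal: "rm.subspace (point_ideal Q)"
  by (simp add: point_ideal_def ideal_gen_ideal)

lemma ideal_pow_ideal: "rm.subspace (ideal_pow I n)"
  by (cases n) (simp_all add: ideal_prod_def ideal_gen_ideal)

lemma ideal_mult: "rm.subspace I \<Longrightarrow> f \<in> I \<Longrightarrow> g * f \<in> I"
  by (rule rm.subspace_scale)

lemma ideal_mult_right: "rm.subspace I \<Longrightarrow> f \<in> I \<Longrightarrow> f * g \<in> I"
  by (subst mult.commute) (rule ideal_mult)

lemma ideal_pow_Suc_mult: "f \<in> I \<Longrightarrow> g \<in> ideal_pow I n \<Longrightarrow> f * g \<in> ideal_pow I (Suc n)"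
  by (auto simp: ideal_prod_def ideal_gen_def intro!: rm.span_base)

lemma ideal_pow_power_mult: "f \<in> I \<Longrightarrow> g \<in> ideal_pow I n \<Longrightarrow> f ^ k * g \<in> ideal_pow I (k + n)"
proof (induction k)
  case (Suc k)
  then show ?case using ideal_pow_Suc_mult[of f I "f ^ k * g" "k + n"] by (simp only: power_Suc mult.assoc add_Suc)
qed simp

lemma ideal_pow_antimono: "m \<le> n \<Longrightarrow> ideal_pow I n \<subseteq> ideal_pow I m"
proof (induction rule: dec_induct)
  case (step n)
  have "ideal_prod I (ideal_pow I n) \<subseteq> ideal_pow I n"
    unfolding ideal_prod_def ideal_gen_def
    by (rule rm.span_minimal) (auto intro: ideal_mult ideal_pow_ideal)
  with step show ?case by simp
qed simp

text \<open>Each factor from the point ideal has zero constant term on a line through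
  \<open>q\<close>, hence contributes one factor \<open>s\<close>. This converts membership in a
  power of the ideal into vanishing Taylor coefficients, for every direction
  \<open>v\<close>.\<close>

lemma dvd_psub:
  assumes "F \<in> ideal_pow (point_ideal Q) n" "q \<in> Q"
  shows "[:0, 1:] ^ n dvd psub q v F"
  using assms(1)
proof (induction n arbitrary: F)
  case (Suc n)
  have "F \<in> rm.span {a * b |a b. a \<in> point_ideal Q \<and> b \<in> ideal_pow (point_ideal Q) n}"
    using Suc.prems by (simp add: ideal_prod_def ideal_gen_def)
  then show ?case
  proof (induction rule: rm.span_induct_alt)
    case (step c x y)
    then obtain a b where x: "x = a * b" "a \<in> point_ideal Q" "b \<in> ideal_pow (point_ideal Q) n"
      by blast
    have "[:0, 1:] dvd psub q v a"
      using eval3_point_ideal[OF x(2) assms(2)]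
      by (simp add: coeff_0_psub[symmetric, of _ _ v] dvd_iff_poly_eq_0[of 0, simplified] poly_0_coeff_0)
    then have "[:0, 1:] ^ Suc n dvd psub q v x"
      using Suc.IH[OF x(3)] by (simp only: x(1) psub_mult power_Suc mult_dvd_mono)
    then show ?case
      using step by (simp add: psub_add psub_mult dvd_add dvd_mult)
  qed simp
qed simp

text \<open>The pairs are the exponents of monomials of degree below \<open>m\<close> in two local
  parameters; their number is the degree of an \<open>m\<close>-fold point. The induction adds the
  diagonal \<open>b + c = m\<close>.\<close>

lemma card_triangle: "card {(b, c). b + c < (m::nat)} = (m + 1) choose 2"
  and finite_triangle: "finite {(b, c). b + c < (m::nat)}"
proof (induction m)
  case 0
  {
    case 1
    show ?case by simp
  next
    case 2
    show ?case by simp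
  }
next
  case (Suc m)
  have eq: "{(b, c). b + c < Suc m} = {(b, c). b + c < m} \<union> (\<lambda>b. (b, m - b)) ` {..m}"
    by auto
  {
    case 1
    have "card ((\<lambda>b. (b, m - b)) ` {..m}) = Suc m"
      by (subst card_image) (auto simp: inj_on_def)
    then show ?case
      unfolding eq by (subst card_Un_disjoint) (use Suc in \<open>auto simp: numeral_2_eq_2\<close>)
  next
    case 2
    show ?case unfolding eq using Suc by simp
  }
qed

lemma card_mons: "card (mons d) = (d + 2) choose 2"
proof -
  have "bij_betw (\<lambda>t. (Poly_Mapping.lookup t 1, Poly_Mapping.lookup t 2)) (mons d)
      {(b, c). b + c < d + 1}"
  proof (rule bij_betw_byWitness[where f' = "\<lambda>(b, c). Poly_Mapping.single 1 b +
        (Poly_Mapping.single 2 c + Poly_Mapping.single 3 (d - b - c))"], goal_cases)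
    case 1
    show ?case
    proof
      fix t assume "t \<in> mons d"
      then have "d - Poly_Mapping.lookup t 1 - Poly_Mapping.lookup t 2 = Poly_Mapping.lookup t 3"
        by (auto simp: mons_def mon_deg_def sum_3)
      then show "(case (Poly_Mapping.lookup t 1, Poly_Mapping.lookup t 2) of
          (b, c) \<Rightarrow> Poly_Mapping.single 1 b +
            (Poly_Mapping.single 2 c + Poly_Mapping.single 3 (d - b - c))) = t"
        using exhaust_3 by (intro poly_mapping_eqI) (fastforce simp: lookup_add lookup_single when_def)
    qed
  qed (auto simp: lookup_add lookup_single mons_def mon_deg_def sum_3)
  then show ?thesis
    using card_triangle[of "d + 1"] by (simp add: bij_betw_same_card)
qed

section \<open>Fat points impose at most the expected number of conditions\<close>

text \<open>A minor of the matrix with rows \<open>q\<close> and the variables. If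
  \<open>q $ i \<noteq> 0\<close> and \<open>i, j, k\<close> are distinct, then
  \<open>lin q i j\<close>, \<open>lin q i k\<close> and \<open>var i\<close> are linear coordinates
  of which the first two cut out the point; \<open>fmon\<close> gives the monomials of degree
  \<open>d\<close> in them.\<close>

definition lin :: "'k::comm_ring_1 ^ 3 \<Rightarrow> 3 \<Rightarrow> 3 \<Rightarrow> 'k poly3" where
  "lin q i j = pscale (q $ i) (var j) - pscale (q $ j) (var i)"

definition fmon :: "'k::comm_ring_1 ^ 3 \<Rightarrow> 3 \<Rightarrow> 3 \<Rightarrow> 3 \<Rightarrow> nat \<Rightarrow> nat \<Rightarrow> nat \<Rightarrow> 'k poly3" where
  "fmon q i j k d b c = lin q i j ^ b * (lin q i k ^ c * var i ^ (d - (b + c)))"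

lemma lin_in_forms: "lin q i j \<in> forms 1" for q :: "'k::field ^ 3"
  unfolding lin_def
  by (intro pv.subspace_diff pv.subspace_scale subspace_forms var_in_forms)

lemma psub_lin: "psub p v (lin q i j) =
    [:q $ i * p $ j - q $ j * p $ i, q $ i * v $ j - q $ j * v $ i:]"
  by (simp add: lin_def psub_diff psub_pscale psub_var)

lemma eval3_lin: "eval3 (lin q i j) p = q $ i * p $ j - q $ j * p $ i"
  by (simp add: coeff_0_psub[of p p, symmetric] psub_lin)

lemma eval3_var: "eval3 (var i) p = p $ i"
  by (simp add: coeff_0_psub[of p p, symmetric] psub_var)

lemma lin_in_point_ideal: "lin q i j \<in> point_ideal (vec.span {q})" for q :: "'k::field ^ 3"
  by (rule form_in_point_ideal[OF lin_in_forms]) (simp add: eval3_lin)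

lemma obtain_frame:
  fixes q :: "'k::field ^ 3"
  assumes "q \<noteq> 0"
  obtains i j k :: 3 where "q $ i \<noteq> 0" "i \<noteq> j" "i \<noteq> k" "j \<noteq> k" "UNIV = {i, j, k}"
proof -
  obtain i where i: "q $ i \<noteq> 0" using assms by (auto simp: vec_eq_iff)
  have d: "(1::3) \<noteq> 2" "(1::3) \<noteq> 3" "(2::3) \<noteq> 3" by simp_all
  consider "i = 1" | "i = 2" | "i = 3" using exhaust_3 by blast
  then show ?thesis
  proof cases
    case 1
    show ?thesis by (rule that[of 1 2 3]) (use i 1 UNIV_3 d in auto)
  next
    case 2
    show ?thesis by (rule that[of 2 1 3]) (use i 2 UNIV_3 d in auto)
  next
    case 3
    show ?thesis by (rule that[of 3 1 2]) (use i 3 UNIV_3 d in auto)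
  qed
qed

lemma fmon_in_forms:
  fixes q :: "'k::field ^ 3"
  assumes "b + c \<le> d"
  shows "fmon q i j k d b c \<in> forms d"
proof -
  have "fmon q i j k d b c \<in> forms (b * 1 + (c * 1 + (d - (b + c)) * 1))"
    unfolding fmon_def by (intro forms_mult forms_power lin_in_forms var_in_forms)
  then show ?thesis using assms by simp
qed

definition fspan :: "'k::field ^ 3 \<Rightarrow> 3 \<Rightarrow> 3 \<Rightarrow> 3 \<Rightarrow> nat \<Rightarrow> 'k poly3 set" where
  "fspan q i j k d = pv.span ((\<lambda>(b, c). fmon q i j k d b c) ` {(b, c). b + c < Suc d})"

lemma fmon_in_fspan: "b + c \<le> d \<Longrightarrow> fmon q i j k d b c \<in> fspan q i j k d"
  unfolding fspan_def by (rule pv.span_base) force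

lemma fspan_mult:
  assumes "G \<in> fspan q i j k d"
    and "\<And>b c. b + c \<le> d \<Longrightarrow> L * fmon q i j k d b c \<in> fspan q i j k (Suc d)"
  shows "L * G \<in> fspan q i j k (Suc d)"
proof -
  have "L * G \<in> pv.span ((*) L ` (\<lambda>(b, c). fmon q i j k d b c) ` {(b, c). b + c < Suc d})"
    by (rule mult_span) (use assms(1) in \<open>simp add: fspan_def\<close>)
  also have "\<dots> \<subseteq> fspan q i j k (Suc d)"
    by (rule pv.span_minimal) (use assms(2) in \<open>auto simp: fspan_def\<close>)
  finally show ?thesis .
qed

lemma fspan_var:
  assumes "q $ i \<noteq> 0" "UNIV = {i, j, k}" "G \<in> fspan q i j k d"
  shows "var l * G \<in> fspan q i j k (Suc d)"
proof -
  have i: "var i * G \<in> fspan q i j k (Suc d)" if "G \<in> fspan q i j k d" for G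
  proof (rule fspan_mult[OF that])
    fix b c assume bc: "b + c \<le> d"
    have "var i * fmon q i j k d b c = fmon q i j k (Suc d) b c"
      by (simp only: fmon_def add_Suc_right Suc_diff_le[OF bc] power_Suc mult.left_commute[of "var i"])
    then show "var i * fmon q i j k d b c \<in> fspan q i j k (Suc d)"
      using bc by (simp add: fmon_in_fspan)
  qed
  have j: "lin q i j * G \<in> fspan q i j k (Suc d)"
  proof (rule fspan_mult[OF assms(3)])
    fix b c assume bc: "b + c \<le> d"
    have "lin q i j * fmon q i j k d b c = fmon q i j k (Suc d) (Suc b) c"
      by (simp only: fmon_def add_Suc diff_Suc_Suc power_Suc mult.assoc)
    then show "lin q i j * fmon q i j k d b c \<in> fspan q i j k (Suc d)"
      using bc by (simp add: fmon_in_fspan)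
  qed
  have k: "lin q i k * G \<in> fspan q i j k (Suc d)"
  proof (rule fspan_mult[OF assms(3)])
    fix b c assume bc: "b + c \<le> d"
    have "lin q i k * fmon q i j k d b c = fmon q i j k (Suc d) b (Suc c)"
      by (simp only: fmon_def add_Suc_right diff_Suc_Suc power_Suc mult.assoc
          mult.left_commute[of "lin q i k" "lin q i j ^ b"])
    then show "lin q i k * fmon q i j k d b c \<in> fspan q i j k (Suc d)"
      using bc by (simp add: fmon_in_fspan)
  qed
  \<comment> \<open>The definition of \<open>lin\<close> solved for \<open>var l\<close>, possible
    because \<open>q $ i \<noteq> 0\<close>. Each of the three coordinate forms raises one exponent
    of \<open>fmon\<close>, so multiplication by \<open>var l\<close> stays in the span.\<close>
  have l: "var l = pscale (inverse (q $ i)) (lin q i l + pscale (q $ l) (var i))" for l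
    using assms(1) by (simp add: lin_def)
  have "var l * G \<in> fspan q i j k (Suc d)" if "lin q i l * G \<in> fspan q i j k (Suc d)" for l
  proof -
    have "var l * G = pscale (inverse (q $ i)) (lin q i l * G + pscale (q $ l) (var i * G))"
      by (subst l) (simp only: pscale_mult_left[symmetric] distrib_right)
    then show ?thesis
      using that i[OF assms(3)]
      by (simp only: fspan_def) (intro pv.span_scale pv.span_add)
  qed
  moreover have "l = i \<or> l = j \<or> l = k" using assms(2) by blast
  ultimately show ?thesis using i[OF assms(3)] j k by blast
qed

lemma fspan_var_power:
  assumes "q $ i \<noteq> 0" "UNIV = {i, j, k}" "G \<in> fspan q i j k d"
  shows "var l ^ n * G \<in> fspan q i j k (n + d)"
proof (induction n)
  case (Suc n)
  from fspan_var[OF assms(1,2) this, of l] show ?case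
    by (simp only: power_Suc mult.assoc add_Suc)
qed (use assms in simp)

lemma forms_subset_fspan:
  assumes "q $ i \<noteq> 0" "UNIV = {i, j, k}"
  shows "forms d \<subseteq> fspan q i j k d"
proof -
  have "Poly_Mapping.single t 1 \<in> fspan q i j k d" if "t \<in> mons d" for t
  proof -
    have "1 \<in> fspan q i j k 0"
      using fmon_in_fspan[of 0 0 0 q i j k] by (simp add: fmon_def)
    then have "Poly_Mapping.single t 1 \<in> fspan q i j k
      (Poly_Mapping.lookup t 1 + (Poly_Mapping.lookup t 2 + (Poly_Mapping.lookup t 3 + 0)))"
      unfolding single_eq_vars by (intro fspan_var_power assms)
    moreover have "Poly_Mapping.lookup t 1 + (Poly_Mapping.lookup t 2 + (Poly_Mapping.lookup t 3 + 0)) = d"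
      using that by (simp add: mons_def mon_deg_def sum_3)
    ultimately show ?thesis by simp
  qed
  then have "pv.span ((\<lambda>t. Poly_Mapping.single t 1) ` mons d) \<subseteq> fspan q i j k d"
    unfolding fspan_def by (intro pv.span_minimal) auto
  then show ?thesis using forms_subset_span by blast
qed

text \<open>In coordinates adapted to the point, a monomial with \<open>b + c \<ge> m\<close> lies
  in the \<open>m\<close>-th power, so the monomials with \<open>b + c < m\<close> span the
  quotient.\<close>

lemma hilbert_point_power:
  assumes "Q \<in> (proj_plane :: ('k::field ^ 3) set set)"
  shows "hilbert_function (ideal_pow (point_ideal Q) m) d \<le> (m + 1) choose 2"
proof -
  obtain q where q: "q \<noteq> 0" "Q = vec.span {q}" using obtain_rep[OF assms] .
  obtain i j k where f: "q $ i \<noteq> 0" "UNIV = {i, j, k}" using obtain_frame[OF q(1)] .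
  define I where "I = ideal_pow (point_ideal Q) m"
  have I: "rm.subspace I" unfolding I_def by (rule ideal_pow_ideal)
  define B where "B = (\<lambda>(b, c). fmon q i j k d b c) ` {(b, c). b + c < m}"
  have "fmon q i j k d b c \<in> pv.span (B \<union> (I \<inter> forms d))" if "b + c \<le> d" for b c
  proof (cases "b + c < m")
    case True
    then show ?thesis unfolding B_def by (intro pv.span_base UnI1) force
  next
    case False
    have "lin q i j ^ b * (lin q i k ^ c * var i ^ (d - (b + c))) \<in> ideal_pow (point_ideal Q) (b + (c + 0))"
      by (intro ideal_pow_power_mult) (simp_all add: q(2) lin_in_point_ideal)
    then have "fmon q i j k d b c \<in> I"
      using ideal_pow_antimono[of m "b + c" "point_ideal Q"] False by (auto simp: fmon_def I_def)
    then show ?thesis using fmon_in_forms[OF that] by (intro pv.span_base) blast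
  qed
  then have "fspan q i j k d \<subseteq> pv.span (B \<union> (I \<inter> forms d))"
    unfolding fspan_def by (intro pv.span_minimal) auto
  then have "hilbert_function I d \<le> card B"
    using forms_subset_fspan[OF f, of d] finite_triangle[of m]
    by (intro hilbert_le I) (auto simp: B_def)
  also have "\<dots> \<le> (m + 1) choose 2"
    unfolding B_def card_triangle[symmetric] by (intro card_image_le finite_triangle)
  finally show ?thesis by (simp add: I_def)
qed

text \<open>Two independent linear forms through a point form a regular sequence; restricting to a line
  on which the first vanishes and the second does not makes this visible.\<close>
lemma lin_dvd:
  fixes q :: "'k::field ^ 3"
  assumes q: "q $ i \<noteq> 0" and d: "i \<noteq> j" "i \<noteq> k" "j \<noteq> k" "UNIV = {i, j, k}"
    and F: "F \<in> forms d" and eq: "lin q i k * F = lin q i j * G"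
  shows "lin q i j dvd F"
proof -
  have "F \<in> fspan q i j k d" using forms_subset_fspan[OF q d(4)] F by blast
  \<comment> \<open>Division by \<open>lin q i j\<close>: only monomials with \<open>b = 0\<close>
    remain, and the aim is to show that this remainder vanishes.\<close>
  then have "\<exists>F' w. F = lin q i j * F' + (\<Sum>c\<le>d. pscale (w c) (fmon q i j k d 0 c))"
    unfolding fspan_def
  proof (induction rule: pv.span_induct_alt)
    case base
    show ?case by (intro exI[of _ 0] exI[of _ "\<lambda>_. 0"]) simp
  next
    case (step u x y)
    then obtain b c F' w where x: "x = fmon q i j k d b c" "b + c \<le> d"
      and y: "y = lin q i j * F' + (\<Sum>c\<le>d. pscale (w c) (fmon q i j k d 0 c))"
      by auto
    show ?case
    proof (cases b)
      case 0
      have "pscale u x = (\<Sum>e\<le>d. pscale (if e = c then u else 0) (fmon q i j k d 0 e))"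
        using x 0 by (subst sum.remove[of _ c]) auto
      then have "pscale u x + y = lin q i j * F' +
          (\<Sum>e\<le>d. pscale ((if e = c then u else 0) + w e) (fmon q i j k d 0 e))"
        unfolding y by (simp only: pv.scale_left_distrib sum.distrib add.left_commute)
      then show ?thesis by (intro exI)
    next
      case (Suc b')
      have "pscale u x + y = lin q i j *
            (pscale u (lin q i j ^ b' * (lin q i k ^ c * var i ^ (d - (b + c)))) + F') +
          (\<Sum>c\<le>d. pscale (w c) (fmon q i j k d 0 c))"
        unfolding y x by (simp only: fmon_def Suc pscale_mult_right distrib_left mult.assoc
            power_Suc add.assoc)
      then show ?thesis by (intro exI)
    qed
  qed
  then obtain F' w where F': "F = lin q i j * F' + (\<Sum>c\<le>d. pscale (w c) (fmon q i j k d 0 c))"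
    by blast
  \<comment> \<open>On the line \<open>e_k + s q\<close> the form \<open>lin q i j\<close> is zero,
    \<open>lin q i k\<close> is the constant \<open>q $ i\<close> and \<open>var i\<close> is
    \<open>s\<close> times \<open>q $ i\<close>. So \<open>F\<close> vanishes on it, while the
    remainder monomials become multiples of the distinct powers \<open>s^(d - c)\<close>.\<close>
  define ps where "ps = psub (axis k 1) q"
  have a: "ps (lin q i j) = 0" and b: "ps (lin q i k) = [:q $ i:]" and u: "ps (var i) = [:0, q $ i:]"
    using d by (simp_all add: ps_def psub_lin psub_var axis_def)
  have psm: "ps (x * y) = ps x * ps y" for x y
    by (simp only: ps_def psub_mult)
  have "ps (lin q i k * F) = ps (lin q i j * G)" by (simp only: eq)
  then have "[:q $ i:] * ps F = 0"
    by (simp only: psm a b mult_zero_left)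
  then have F0: "ps F = 0" using q by simp
  have mon: "[:0, x:] ^ n = monom (x ^ n) n" for x :: 'k and n
    by (induction n) (simp_all add: monom_0 monom_Suc[symmetric] smult_monom)
  have "ps F = (\<Sum>c\<le>d. smult (w c) (ps (fmon q i j k d 0 c)))"
    by (subst F') (simp only: ps_def psub_add psub_sum psub_pscale psub_mult a[unfolded ps_def]
        mult_zero_left add_0)
  also have "\<dots> = (\<Sum>c\<le>d. monom (w c * (q $ i) ^ d) (d - c))"
  proof (rule sum.cong[OF refl])
    fix c assume c: "c \<in> {..d}"
    have "ps (fmon q i j k d 0 c) = [:q $ i:] ^ c * monom ((q $ i) ^ (d - c)) (d - c)"
      by (simp only: fmon_def ps_def psub_mult psub_power b[unfolded ps_def] u[unfolded ps_def] mon
        power_0 mult_1 add_0)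
    also have "\<dots> = monom ((q $ i) ^ d) (d - c)"
      using c by (simp add: poly_const_pow smult_monom power_add[symmetric])
    finally show "smult (w c) (ps (fmon q i j k d 0 c)) = monom (w c * (q $ i) ^ d) (d - c)"
      by (simp add: smult_monom)
  qed
  finally have s: "(\<Sum>c\<le>d. monom (w c * (q $ i) ^ d) (d - c)) = 0" using F0 by simp
  have "w c = 0" if "c \<le> d" for c
  proof -
    have "0 = coeff (\<Sum>c\<le>d. monom (w c * (q $ i) ^ d) (d - c)) (d - c)" using s by simp
    also have "\<dots> = (\<Sum>e\<le>d. if e = c then w e * (q $ i) ^ d else 0)"
      unfolding coeff_sum by (rule sum.cong) (use that in auto)
    also have "\<dots> = w c * (q $ i) ^ d" using that by simp
    finally show ?thesis using q by simp
  qed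
  then have "F = lin q i j * F'" by (subst F') simp
  then show ?thesis by simp
qed

section \<open>Complete intersections\<close>

lemma ideal_gen_single: "f \<in> ideal_gen {F} \<longleftrightarrow> (\<exists>r. f = r * F)"
  unfolding ideal_gen_def rm.span_breakdown_eq rm.span_empty by simp

lemma ideal_gen_pair: "f \<in> ideal_gen {F, G} \<longleftrightarrow> (\<exists>r s. f = r * F + s * G)"
  unfolding ideal_gen_def rm.span_breakdown_eq rm.span_empty
  by (simp add: algebra_simps)

text \<open>Forms of degree \<open>d - e\<close>, where a negative degree means only the zero form.\<close>
definition shifted :: "nat \<Rightarrow> nat \<Rightarrow> 'k::comm_ring_1 poly3 set" where
  "shifted d e = (if e \<le> d then forms (d - e) else {0})"

lemma subspace_shifted: "pv.subspace (shifted d e :: 'k::field poly3 set)"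
  by (simp add: shifted_def subspace_forms pv.subspace_single_0)

lemma zero_in_forms: "(0 :: 'k::field poly3) \<in> forms d"
  by (simp add: forms_def)

lemma shifted_mult:
  assumes "G \<in> forms e" "r \<in> shifted d e"
  shows "r * G \<in> (forms d :: 'k::field poly3 set)"
  using assms forms_mult[of r "d - e" G e] by (auto simp: shifted_def zero_in_forms split: if_splits)

lemma shifted_forms_mult:
  assumes "G \<in> forms n" "r \<in> shifted d e"
  shows "G * r \<in> (shifted (n + d) e :: 'k::field poly3 set)"
proof (cases "e \<le> d")
  case True
  then show ?thesis using assms forms_mult[of G n r "d - e"] by (simp add: shifted_def)
next
  case False
  then have "r = 0" using assms by (simp add: shifted_def)
  then show ?thesis using pv.subspace_0[OF subspace_shifted] by (metis mult_zero_right)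
qed

text \<open>The component of degree \<open>d - e\<close> is selected by
  \<open>mon_deg t + e = d\<close>; without subtraction the case \<open>d < e\<close> selects
  nothing and yields \<open>0\<close>.\<close>

lemma homogeneous_part:
  fixes g :: "'k::field poly3"
  obtains r where "r \<in> shifted d e"
    "\<And>t. t \<in> Poly_Mapping.keys (g - r) \<Longrightarrow> mon_deg t + e \<noteq> d"
proof -
  define r where "r = (\<Sum>t\<in>{t \<in> Poly_Mapping.keys g. mon_deg t + e = d}.
    Poly_Mapping.single t (Poly_Mapping.lookup g t))"
  have l: "Poly_Mapping.lookup r t = (if mon_deg t + e = d then Poly_Mapping.lookup g t else 0)" for t
  proof -
    have "Poly_Mapping.lookup r t = (\<Sum>s\<in>{s \<in> Poly_Mapping.keys g. mon_deg s + e = d}.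
        if s = t then Poly_Mapping.lookup g s else 0)"
      by (simp add: r_def lookup_sum lookup_single when_def)
    also have "\<dots> = (if mon_deg t + e = d then Poly_Mapping.lookup g t else 0)"
      by (subst sum.delta) (auto simp: in_keys_iff)
    finally show ?thesis .
  qed
  show ?thesis
  proof (rule that)
    have "r = 0" if "\<not> e \<le> d"
      by (rule poly_mapping_eqI) (use that in \<open>auto simp: l\<close>)
    moreover have "r \<in> forms (d - e)" if "e \<le> d"
      using that by (auto simp: forms_def in_keys_iff l split: if_splits)
    ultimately show "r \<in> shifted d e" by (simp add: shifted_def)
  next
    fix t assume "t \<in> Poly_Mapping.keys (g - r)"
    then show "mon_deg t + e \<noteq> d" by (auto simp: in_keys_iff lookup_minus l)
  qed
qed

lemma keys_mult_form:
  fixes g :: "'k::field poly3"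
  assumes "F \<in> forms e" "\<And>t. t \<in> Poly_Mapping.keys g \<Longrightarrow> mon_deg t + e \<noteq> d"
    and "t \<in> Poly_Mapping.keys (g * F)"
  shows "mon_deg t \<noteq> d"
proof -
  obtain u v where t: "t = u + v" "u \<in> Poly_Mapping.keys g" "v \<in> Poly_Mapping.keys F"
    using assms(3) keys_mult[of g F] by blast
  have "mon_deg t = mon_deg u + e"
    using assms(1) t by (auto simp: mon_deg_def lookup_add sum.distrib forms_def)
  then show ?thesis using assms(2)[OF t(2)] by simp
qed

text \<open>After the coefficients are replaced by their components of the right degree, the error
  is a form of degree \<open>d\<close>, yet it also equals a combination without any monomial of
  degree \<open>d\<close>.\<close>

lemma homogeneous_combination:
  fixes F G :: "'k::field poly3"
  assumes f: "f \<in> forms d" "f \<in> ideal_gen {F, G}" and F: "F \<in> forms e1" and G: "G \<in> forms e2"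
  obtains r s where "r \<in> shifted d e1" "s \<in> shifted d e2" "f = r * F + s * G"
proof -
  obtain r' s' where rs': "f = r' * F + s' * G" using f(2) by (auto simp: ideal_gen_pair)
  obtain r where r: "r \<in> shifted d e1"
    "\<And>t. t \<in> Poly_Mapping.keys (r' - r) \<Longrightarrow> mon_deg t + e1 \<noteq> d"
    by (rule homogeneous_part[of d e1 r']) blast
  obtain s where s: "s \<in> shifted d e2"
    "\<And>t. t \<in> Poly_Mapping.keys (s' - s) \<Longrightarrow> mon_deg t + e2 \<noteq> d"
    by (rule homogeneous_part[of d e2 s']) blast
  have eq: "f - (r * F + s * G) = (r' - r) * F + (s' - s) * G"
    unfolding rs' left_diff_distrib by (rule add_diff_add)
  have h: "f - (r * F + s * G) \<in> forms d"
    by (intro pv.subspace_diff pv.subspace_add subspace_forms f shifted_mult[OF F r(1)]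
        shifted_mult[OF G s(1)])
  have "Poly_Mapping.keys (f - (r * F + s * G)) = {}"
  proof (rule ccontr)
    assume "Poly_Mapping.keys (f - (r * F + s * G)) \<noteq> {}"
    then obtain t where t: "t \<in> Poly_Mapping.keys (f - (r * F + s * G))" by blast
    then have "mon_deg t = d" using h by (auto simp: forms_def)
    moreover have "t \<in> Poly_Mapping.keys ((r' - r) * F) \<union> Poly_Mapping.keys ((s' - s) * G)"
      using t unfolding eq by (rule subsetD[OF keys_add])
    ultimately show False
      using keys_mult_form[OF F r(2), where t = t] keys_mult_form[OF G s(2), where t = t] by auto
  qed
  then have "f - (r * F + s * G) = 0"
    by (intro poly_mapping_eqI) (metis empty_iff in_keys_iff lookup_zero)
  then have "f = r * F + s * G" by (simp only: right_minus_eq)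
  with r(1) s(1) show ?thesis by (rule that)
qed

lemma syzygy_of_eq:
  fixes l :: "'a::comm_ring_1"
  assumes "l' * (r * F + s * G) = l * (r' * F + s' * G)"
  shows "(l' * r - l * r') * F = (l * s' - l' * s) * G"
proof -
  have "(l' * r) * F + (l' * s) * G = (l * r') * F + (l * s') * G"
    using assms by (simp only: distrib_left mult.assoc)
  then have "(l' * r) * F = (l * r') * F + (l * s') * G - (l' * s) * G"
    by (simp only: eq_diff_eq)
  then show ?thesis by (simp only: left_diff_distrib) simp
qed

section \<open>Regular pairs of forms and their syzygies\<close>

locale regular_forms =
  fixes F G :: "'k::field poly3" and a b :: nat
  assumes F: "F \<in> forms a" and G: "G \<in> forms b" and F0: "F \<noteq> 0"
    and regular: "g * G \<in> ideal_gen {F} \<Longrightarrow> g \<in> ideal_gen {F}"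
begin

text \<open>Powers of a nonzerodivisor modulo \<open>F\<close> are nonzerodivisors. This supplies
  the pair \<open>(F, G^m)\<close> of type \<open>(a, m b)\<close>.\<close>

lemma power: "regular_forms F (G ^ n) a (n * b)"
proof
  show "F \<in> forms a" "F \<noteq> 0" by (fact F F0)+
  show "G ^ n \<in> forms (n * b)" using G by (rule forms_power)
  show "g * G ^ n \<in> ideal_gen {F} \<Longrightarrow> g \<in> ideal_gen {F}" for g
  proof (induction n arbitrary: g)
    case (Suc n)
    have "g * G ^ n * G \<in> ideal_gen {F}"
      using Suc.prems by (simp only: power_Suc2 mult.assoc)
    then show ?case using Suc.IH regular by blast
  qed simp
qed

text \<open>Regularity makes \<open>s\<close> a multiple of \<open>F\<close>, but its degree
  \<open>d - b\<close> is below \<open>a\<close>.\<close>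

lemma no_low_syzygy:
  assumes "s \<in> shifted d b" "d < a + b" "r * F = s * G"
  shows "r = 0" "s = 0"
proof -
  have "s * G \<in> ideal_gen {F}" using assms(3) by (metis ideal_gen_single)
  then have s: "s \<in> ideal_gen {F}" by (rule regular)
  show "s = 0"
  proof (cases "b \<le> d")
    case True
    \<comment> \<open>The zero form serves as a dummy second generator, so that
      \<open>homogeneous_combination\<close> covers a principal ideal.\<close>
    have "s \<in> ideal_gen {F, 0}" using s by (simp add: ideal_gen_single ideal_gen_pair)
    moreover have "s \<in> forms (d - b)" using assms(1) True by (simp add: shifted_def)
    ultimately obtain u v where "u \<in> shifted (d - b) a" "s = u * F + v * 0"
      using homogeneous_combination[OF _ _ F zero_in_forms] by metis
    moreover have "\<not> a \<le> d - b" using True assms(2) by linarith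
    ultimately show ?thesis by (simp add: shifted_def)
  qed (use assms(1) in \<open>simp add: shifted_def\<close>)
  then show "r = 0" using assms(3) F0 by simp
qed

text \<open>Below degree \<open>a + b\<close> the map \<open>(r, s) \<mapsto> r F + s G\<close> on
  homogeneous pairs is injective, so the ideal has the dimension of its domain. For
  \<open>d < e\<close> the term \<open>(d + 2 - e) choose 2\<close> is \<open>0\<close>, in keeping
  with an empty graded piece.\<close>

lemma hilbert_low:
  assumes "d < a + b"
  shows "hilbert_function (ideal_gen {F, G}) d + ((d + 2 - a) choose 2) + ((d + 2 - b) choose 2)
    = (d + 2) choose 2"
proof -
  define M :: "nat \<Rightarrow> (3 \<Rightarrow>\<^sub>0 nat) set" where "M e = (if e \<le> d then mons (d - e) else {})" for e
  have card_M: "card (M e) = (d + 2 - e) choose 2" for e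
  proof (cases "e \<le> d")
    case True
    then have "d + 2 - e = d - e + 2" by simp
    then show ?thesis using True by (simp only: M_def if_True card_mons)
  next
    case False
    then have "d + 2 - e < 2" by simp
    then show ?thesis using False by (simp add: M_def)
  qed
  have fin: "finite (M e)" for e by (simp add: M_def)
  have M: "Poly_Mapping.single t 1 \<in> (shifted d e :: 'k poly3 set)" if "t \<in> M e" for t e
    using that by (auto simp: M_def shifted_def single_in_forms split: if_splits)
  define J where "J = ideal_gen {F, G}"
  have J: "rm.subspace J" by (simp add: J_def ideal_gen_ideal)
  define V where "V = J \<inter> forms d"
  have V: "pv.subspace V" "V \<subseteq> forms d"
    using subspace_ideal_forms[OF J, of d] by (auto simp: V_def)
  have inV: "r * F + s * G \<in> V" if "r \<in> shifted d a" "s \<in> shifted d b" for r s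
  proof -
    have "r * F + s * G \<in> forms d"
      by (intro pv.subspace_add subspace_forms shifted_mult[OF F that(1)] shifted_mult[OF G that(2)])
    then show ?thesis unfolding V_def J_def by (auto simp: ideal_gen_pair)
  qed
  define f where "f z = (case z of Inl t \<Rightarrow> Poly_Mapping.single t 1 * F
    | Inr t \<Rightarrow> Poly_Mapping.single t 1 * G)" for z
  have "card (M a <+> M b) + pv.dim {0::'k poly3} \<le> pv.dim V"
  proof (rule indep_family_dim[where f = f, OF pv.subspace_single_0 _ V])
    show "{0} \<subseteq> V" using V(1) pv.subspace_0 by blast
    show "finite (M a <+> M b)" using fin by simp
  next
    fix z assume "z \<in> M a <+> M b"
    then show "f z \<in> V"
    proof
      fix t assume "t \<in> M a" "z = Inl t"
      then show ?thesis
        using inV[OF M pv.subspace_0[OF subspace_shifted]] by (simp add: f_def)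
    next
      fix t assume "t \<in> M b" "z = Inr t"
      then show ?thesis
        using inV[OF pv.subspace_0[OF subspace_shifted] M] by (simp add: f_def)
    qed
  next
    fix c assume c: "(\<Sum>z\<in>M a <+> M b. pscale (c z) (f z)) \<in> {0}"
    define r where "r = (\<Sum>t\<in>M a. pscale (c (Inl t)) (Poly_Mapping.single t 1))"
    define s where "s = (\<Sum>t\<in>M b. pscale (c (Inr t)) (Poly_Mapping.single t 1))"
    have lr: "Poly_Mapping.lookup r t = c (Inl t)" if "t \<in> M a" for t
      using that fin by (simp add: r_def lookup_sum pscale_eq lookup_single when_def if_distrib cong: if_cong)
    have ls: "Poly_Mapping.lookup s t = c (Inr t)" if "t \<in> M b" for t
      using that fin by (simp add: s_def lookup_sum pscale_eq lookup_single when_def if_distrib cong: if_cong)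
    have s: "- s \<in> shifted d b"
      unfolding s_def by (intro pv.subspace_neg pv.subspace_sum pv.subspace_scale subspace_shifted M)
    have "r * F + s * G = (\<Sum>z\<in>M a <+> M b. pscale (c z) (f z))"
      by (simp add: sum.Plus fin r_def s_def f_def sum_distrib_right pscale_mult_left)
    also have "\<dots> = 0" using c by simp
    finally have "r * F = - s * G" by (simp add: eq_neg_iff_add_eq_0)
    from no_low_syzygy[OF s assms this] have "r = 0" "s = 0" by simp_all
    then show "\<forall>z\<in>M a <+> M b. c z = 0" using lr ls by auto
  qed
  then have ge: "card (M a) + card (M b) \<le> pv.dim V" using fin by (simp add: card_Plus)
  have "V \<subseteq> pv.span (f ` (M a <+> M b))"
  proof
    fix g assume "g \<in> V"
    then obtain r s where rs: "r \<in> shifted d a" "s \<in> shifted d b" "g = r * F + s * G"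
      using homogeneous_combination[OF _ _ F G] by (metis IntD1 IntD2 J_def V_def)
    have ex: "r = (\<Sum>t\<in>M e. pscale (Poly_Mapping.lookup r t) (Poly_Mapping.single t 1))"
      if "r \<in> shifted d e" for r :: "'k poly3" and e
      using that form_expand[of r "d - e"] by (auto simp: shifted_def M_def split: if_splits)
    have "r * F = (\<Sum>t\<in>M a. pscale (Poly_Mapping.lookup r t) (f (Inl t)))"
      by (subst ex[OF rs(1)]) (simp add: sum_distrib_right pscale_mult_left f_def)
    moreover have "s * G = (\<Sum>t\<in>M b. pscale (Poly_Mapping.lookup s t) (f (Inr t)))"
      by (subst ex[OF rs(2)]) (simp add: sum_distrib_right pscale_mult_left f_def)
    ultimately show "g \<in> pv.span (f ` (M a <+> M b))"
      unfolding rs(3) by (simp only:) (intro pv.span_add pv.span_sum pv.span_scale pv.span_base; blast)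
  qed
  then have "pv.dim V \<le> card (f ` (M a <+> M b))" using fin by (intro pv.dim_le_card) auto
  also have "\<dots> \<le> card (M a) + card (M b)"
    using card_image_le[of "M a <+> M b" f] fin by (simp add: card_Plus)
  finally have dimV: "pv.dim V = card (M a) + card (M b)" using ge by simp
  have "card (mons d) + pv.dim {0::'k poly3} \<le> pv.dim (forms d :: 'k poly3 set)"
  proof (rule indep_family_dim[where f = "\<lambda>t. Poly_Mapping.single t 1", OF pv.subspace_single_0 _ subspace_forms order_refl])
    fix c :: "_ \<Rightarrow> 'k" assume c: "(\<Sum>t\<in>mons d. pscale (c t) (Poly_Mapping.single t 1)) \<in> {0}"
    have "Poly_Mapping.lookup (\<Sum>t\<in>mons d. pscale (c t) (Poly_Mapping.single t 1)) t = c t"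
      if "t \<in> mons d" for t
      using that by (simp add: lookup_sum pscale_eq lookup_single when_def if_distrib cong: if_cong)
    then show "\<forall>t\<in>mons d. c t = 0" using c by simp
  qed (simp_all add: zero_in_forms single_in_forms)
  moreover have "pv.dim (forms d :: 'k poly3 set) \<le> card (mons d)"
    using pv.dim_le_card[OF forms_subset_span] card_image_le[of "mons d"] by (meson finite_imageI finite_mons order_trans)
  ultimately have "pv.dim (forms d :: 'k poly3 set) = (d + 2) choose 2"
    using card_mons by simp
  then show ?thesis
    using hilbert_add_dim[OF J, of d] dimV card_M by (simp add: V_def J_def)
qed

text \<open>Writing \<open>l H = r F + s G\<close> and \<open>l' H = r' F + s' G\<close> with linear forms \<open>l, l'\<close> through the point, the syzygy
  \<open>(l' r - l r') F = (l s' - l' s) G\<close> has too small a degree to be nontrivial.\<close>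
lemma low_degree_socle:
  assumes q: "q $ i \<noteq> 0" and fr: "i \<noteq> j" "i \<noteq> k" "j \<noteq> k" "UNIV = {i, j, k}"
    and H: "H \<in> forms d" "d + 2 < a + b"
    and lH: "lin q i j * H \<in> ideal_gen {F, G}" "lin q i k * H \<in> ideal_gen {F, G}"
  shows "H \<in> ideal_gen {F, G}"
proof -
  define l l' where "l = lin q i j" and "l' = lin q i k"
  have l: "l \<in> forms 1" "l' \<in> forms 1" unfolding l_def l'_def by (rule lin_in_forms)+
  have l0: "l \<noteq> 0"
  proof
    assume "l = 0"
    then have "eval3 (lin q i j) (axis j 1) = 0" by (simp add: l_def)
    then show False using q fr by (simp add: eval3_lin axis_def)
  qed
  obtain r s where rs: "r \<in> shifted (1 + d) a" "s \<in> shifted (1 + d) b" "l * H = r * F + s * G"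
    using homogeneous_combination[OF forms_mult[OF l(1) H(1)] _ F G] lH(1) unfolding l_def by blast
  obtain r' s' where rs': "r' \<in> shifted (1 + d) a" "s' \<in> shifted (1 + d) b" "l' * H = r' * F + s' * G"
    using homogeneous_combination[OF forms_mult[OF l(2) H(1)] _ F G] lH(2) unfolding l'_def by blast
  have "l' * (r * F + s * G) = l * (r' * F + s' * G)"
    unfolding rs(3)[symmetric] rs'(3)[symmetric] by (rule mult.left_commute)
  then have eq: "(l' * r - l * r') * F = (l * s' - l' * s) * G"
    by (rule syzygy_of_eq)
  have "l * s' - l' * s \<in> shifted (1 + (1 + d)) b"
    by (intro pv.subspace_diff subspace_shifted shifted_forms_mult l rs rs')
  from no_low_syzygy[OF this _ eq] H(2) have z: "l' * r - l * r' = 0" "l * s' - l' * s = 0"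
    by simp_all
  \<comment> \<open>The trivial syzygy says that \<open>l\<close> divides \<open>l' r\<close> and
    \<open>l' s\<close>; by \<open>lin_dvd\<close> it divides \<open>r\<close> and \<open>s\<close>,
    and can then be cancelled from \<open>l H = r F + s G\<close>.\<close>
  have dvd: "l dvd u" if "u \<in> shifted (1 + d) e" "l' * u = l * u'" for u u' e
  proof (cases "e \<le> 1 + d")
    case True
    then have "u \<in> forms (1 + d - e)" using that(1) by (simp add: shifted_def)
    then show ?thesis using lin_dvd[OF q fr] that(2) unfolding l_def l'_def by blast
  qed (use that in \<open>simp add: shifted_def\<close>)
  have "l' * r = l * r'" "l * s' = l' * s" using z by (simp_all only: right_minus_eq)
  then have "l dvd r" and "l dvd s" using dvd[OF rs(1)] dvd[OF rs(2) sym] by blast+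
  then obtain u v where "r = l * u" "s = l * v" by (auto elim!: dvdE)
  then have "l * H = l * (u * F + v * G)" using rs(3) by (simp only: distrib_left mult.assoc)
  then have "H = u * F + v * G" using l0 by (simp only: mult_cancel_left) simp
  then show ?thesis unfolding ideal_gen_pair by blast
qed

end

lemma points_ideal_ideal: "rm.subspace (points_ideal X)"
  unfolding points_ideal_def by (intro rm.subspace_Inter) (auto simp: point_ideal_ideal)

text \<open>For \<open>a = x + 1\<close> and \<open>b = y + 1\<close>, with
  \<open>a + b \<ge> 3\<close>, this turns \<open>hilbert_low\<close> in degree
  \<open>a + b - 3\<close> into the value \<open>x y + x + y = a b - 1\<close>.\<close>

lemma choose_two_add: "(x + y + 1) choose 2 = x * y + x + y + (x choose 2) + (y choose 2)"
  by (induction x) (simp_all add: numeral_2_eq_2)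

text \<open>Read with \<open>n = d + 2\<close>: by \<open>hilbert_low\<close> the Hilbert function
  is still below \<open>a b\<close>. At \<open>n = a + b - 1\<close> the gap is exactly
  \<open>1\<close>; from \<open>n + 1\<close> down to \<open>n\<close> the left side loses
  \<open>n\<close> and the right side \<open>(n - a) + (n - b) \<le> n\<close>.\<close>

lemma choose_two_low:
  assumes "1 \<le> a" "1 \<le> b" "n < a + b"
  shows "n choose 2 < a * b + ((n - a) choose 2) + ((n - b) choose 2)"
proof -
  obtain x y where xy: "a = Suc x" "b = Suc y"
    using assms by (metis One_nat_def Suc_le_D)
  have "n \<le> x + y + 1" using assms by (simp add: xy)
  then show ?thesis
  proof (induction rule: inc_induct)
    case base
    then show ?case using choose_two_add[of x y] by (simp add: xy)
  next
    case (step n)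
    have Suc_choose: "Suc k choose 2 = (k choose 2) + k" for k
      by (simp add: numeral_2_eq_2)
    have "(Suc n - c) choose 2 = ((n - c) choose 2) + (n - c)" for c
      by (cases "c \<le> n") (simp_all add: Suc_diff_le Suc_choose)
    moreover have "(n - a) + (n - b) \<le> n" using step.hyps by (simp add: xy)
    ultimately show ?case using step.IH Suc_choose[of n] by simp
  qed
qed

text \<open>If all minors \<open>lin p i l\<close> vanished at \<open>q\<close>, then
  \<open>q\<close> would be proportional to \<open>p\<close>.\<close>

lemma obtain_linear_separator:
  fixes P :: "('k::field ^ 3) set"
  assumes "P \<in> proj_plane" "Q \<in> proj_plane" "P \<noteq> Q" "Q = vec.span {q}"
  obtains L where "L \<in> forms 1" "L \<in> point_ideal P" "eval3 L q \<noteq> 0"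
proof -
  obtain p where p: "p \<noteq> 0" "P = vec.span {p}" using obtain_rep[OF assms(1)] .
  have q0: "q \<noteq> 0"
  proof
    assume "q = 0"
    moreover obtain q' where "q' \<noteq> 0" "q' \<in> Q" using obtain_rep[OF assms(2)] .
    ultimately show False using assms(4) by simp
  qed
  obtain i j k where f: "p $ i \<noteq> 0" "UNIV = {i, j, k}" using obtain_frame[OF p(1)] .
  have "\<exists>l. eval3 (lin p i l) q \<noteq> 0"
  proof (rule ccontr)
    assume "\<nexists>l. eval3 (lin p i l) q \<noteq> 0"
    then have "p $ i * q $ l = p $ l * q $ i" for l by (simp add: eval3_lin)
    then have l: "q $ l = (q $ i / p $ i) * p $ l" for l using f(1) by (simp add: field_simps)
    define c where "c = q $ i / p $ i"
    have e: "q = c *s p"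
      unfolding vec_eq_iff vector_smult_component c_def by (intro allI l)
    then have "c \<noteq> 0" using q0 by auto
    then have "vec.span {q} = vec.span {p}"
      unfolding e using vec.span_image_scale[of "{p}" "\<lambda>_. c"] by simp
    then show False using assms p by simp
  qed
  then show ?thesis using that lin_in_forms lin_in_point_ideal p(2) by blast
qed

lemma hilbert_point_ideal:
  assumes "Q \<in> (proj_plane :: ('k::field ^ 3) set set)"
  shows "hilbert_function (point_ideal Q) d \<le> 1"
proof -
  have "ideal_pow (point_ideal Q) 1 \<subseteq> point_ideal Q"
    unfolding One_nat_def ideal_pow.simps ideal_prod_def ideal_gen_def
    by (rule rm.span_minimal) (auto intro!: ideal_mult_right point_ideal_ideal)
  then have "hilbert_function (point_ideal Q) d \<le> hilbert_function (ideal_pow (point_ideal Q) 1) d"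
    by (intro hilbert_antimono ideal_pow_ideal point_ideal_ideal) blast
  also have "\<dots> \<le> (1 + 1) choose 2" by (rule hilbert_point_power[OF assms])
  finally show ?thesis by (simp add: numeral_2_eq_2)
qed

section \<open>Cayley-Bacharach and separators for a complete intersection of points\<close>

locale ci_points = regular_forms F G a b
  for F G :: "'k::field poly3" and a b :: nat +
  fixes X :: "('k ^ 3) set set"
  assumes X: "X \<subseteq> proj_plane" "finite X" "card X = a * b" "points_ideal X = ideal_gen {F, G}"
begin

text \<open>Every linear form through \<open>P\<close> carries \<open>H\<close> into the ideal of
  \<open>X\<close>; two independent ones suffice for \<open>low_degree_socle\<close>.\<close>

lemma cayley_bacharach:
  assumes "H \<in> forms d" "d + 2 < a + b" "P \<in> X" "H \<in> points_ideal (X - {P})"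
  shows "H \<in> ideal_gen {F, G}"
proof -
  have P: "P \<in> proj_plane" using X(1) assms(3) by blast
  obtain p where p: "p \<noteq> 0" "P = vec.span {p}" using obtain_rep[OF P] .
  obtain i j k where f: "p $ i \<noteq> 0" "i \<noteq> j" "i \<noteq> k" "j \<noteq> k" "UNIV = {i, j, k}"
    using obtain_frame[OF p(1)] .
  have "lin p i l * H \<in> points_ideal X" for l
    unfolding points_ideal_def
  proof
    fix Q assume Q: "Q \<in> X"
    show "lin p i l * H \<in> point_ideal Q"
    proof (cases "Q = P")
      case True
      then have "H * lin p i l \<in> point_ideal Q"
        using ideal_mult[OF point_ideal_ideal lin_in_point_ideal] p(2) by blast
      then show ?thesis by (simp only: mult.commute)
    next
      case False
      then have "H \<in> point_ideal Q" using assms(4) Q by (auto simp: points_ideal_def)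
      then show ?thesis by (rule ideal_mult[OF point_ideal_ideal])
    qed
  qed
  then show ?thesis using low_degree_socle[OF f assms(1,2)] X(4) by simp
qed

text \<open>A count: the quotient by \<open>(F, G)\<close> has dimension \<open>a b - 1\<close> in
  degree \<open>a + b - 3\<close>, whereas the \<open>a b - 2\<close> points other than
  \<open>P\<close> and \<open>Q\<close> impose at most \<open>a b - 2\<close> conditions. If all
  forms of this degree through those points vanished at \<open>Q\<close>, Cayley-Bacharach would put
  them into \<open>(F, G)\<close>.\<close>

lemma separator:
  assumes "P \<in> X" "Q \<in> X" "P \<noteq> Q"
  obtains H where "H \<in> forms (a + b - 3)" "H \<in> points_ideal (X - {P, Q})" "H \<notin> point_ideal Q"
proof -
  have c2: "card (X - {P, Q}) + 2 = a * b"
  proof -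
    have "card {P, Q} = 2" using assms by simp
    moreover have "card {P, Q} \<le> card X" using assms X by (intro card_mono) auto
    ultimately show ?thesis using assms X by (simp add: card_Diff_subset)
  qed
  then have ab: "1 \<le> a" "1 \<le> b" by (auto intro!: Suc_leI gr0I)
  then obtain x y where xy: "a = Suc x" "b = Suc y" by (metis One_nat_def Suc_le_D)
  \<comment> \<open>Two distinct points give \<open>a b \<ge> 2\<close>, hence
    \<open>a + b \<ge> 3\<close>, so the subtraction in \<open>a + b - 3\<close> is not
    truncated.\<close>
  have xy1: "1 \<le> x + y" using c2 by (cases x; cases y) (auto simp: xy)
  let ?s = "a + b - 3"
  have s: "?s < a + b" "?s + 2 < a + b" using xy1 by (auto simp: xy)
  have s2: "?s + 2 = x + y + 1" using xy1 by (simp add: xy)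
  have "hilbert_function (ideal_gen {F, G}) ?s + (y choose 2) + (x choose 2) = (x + y + 1) choose 2"
    using hilbert_low[OF s(1)] unfolding s2 by (simp add: xy)
  then have h: "hilbert_function (ideal_gen {F, G}) ?s = x * y + x + y"
    using choose_two_add[of x y] by simp
  show ?thesis
  proof (rule ccontr)
    assume no: "\<not> thesis"
    have "points_ideal (X - {P, Q}) \<inter> forms ?s \<subseteq> ideal_gen {F, G}"
    proof
      fix H assume H: "H \<in> points_ideal (X - {P, Q}) \<inter> forms ?s"
      then have "H \<in> point_ideal Q" using that no by blast
      then have "H \<in> points_ideal (X - {P})" using H unfolding points_ideal_def by blast
      then show "H \<in> ideal_gen {F, G}" using cayley_bacharach[OF _ s(2) assms(1)] H by blast
    qed
    then have "hilbert_function (ideal_gen {F, G}) ?s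
        \<le> hilbert_function (points_ideal (X - {P, Q})) ?s"
      by (rule hilbert_antimono[OF points_ideal_ideal ideal_gen_ideal])
    also have "\<dots> \<le> card (X - {P, Q}) * 1"
      unfolding points_ideal_def
    proof (rule hilbert_INT)
      fix Q' assume "Q' \<in> X - {P, Q}"
      then show "hilbert_function (point_ideal Q') ?s \<le> 1"
        using X(1) by (intro hilbert_point_ideal) blast
    qed (use X(2) point_ideal_ideal in simp_all)
    finally have "x * y + x + y + 2 \<le> a * b" using h c2 by simp
    then show False by (simp add: xy)
  qed
qed

end

lemma complete_intersectionE:
  assumes "complete_intersection X a b"
  obtains F G where "ci_points F G a b X"
proof -
  obtain F G where FG: "F \<in> forms a" "G \<in> forms b" "regular_sequence [F, G]"
      "points_ideal X = ideal_gen {F, G}"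
    using assms unfolding complete_intersection_def by blast
  have reg: "\<And>i g. i < 2 \<Longrightarrow> g * [F, G] ! i \<in> ideal_gen (set (take i [F, G])) \<Longrightarrow>
      g \<in> ideal_gen (set (take i [F, G]))"
    using FG(3) unfolding regular_sequence_def by (metis length_Cons list.size(3) numeral_2_eq_2)
  \<comment> \<open>Regularity at the first entry with multiplier \<open>1\<close>: if
    \<open>F = 0\<close>, then \<open>1\<close> would lie in the zero ideal.\<close>
  have "1 \<in> ideal_gen ({} :: 'a poly3 set)" if "F = 0"
    using reg[of 0 1] that by (simp add: ideal_gen_def)
  then have "F \<noteq> 0" by (auto simp: ideal_gen_def)
  moreover have "g \<in> ideal_gen {F}" if "g * G \<in> ideal_gen {F}" for g
    using reg[of 1 g] that by simp
  ultimately have "ci_points F G a b X"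
    using FG assms by unfold_locales (auto simp: complete_intersection_def)
  then show ?thesis by (rule that)
qed

section \<open>The Hilbert function of equimultiple fat points\<close>

definition uniform_ideal :: "('k::field ^ 3) set set \<Rightarrow> nat \<Rightarrow> 'k poly3 set" where
  "uniform_ideal S m = (\<Inter>Q\<in>S. ideal_pow (point_ideal Q) m)"

lemma uniform_ideal_ideal: "rm.subspace (uniform_ideal S m)"
  unfolding uniform_ideal_def by (intro rm.subspace_Inter) (auto simp: ideal_pow_ideal)

lemma uniform_ideal_Un: "uniform_ideal (S \<union> T) m = uniform_ideal S m \<inter> uniform_ideal T m"
  by (auto simp: uniform_ideal_def)

lemma hilbert_uniform_ideal_le:
  assumes "finite S" "S \<subseteq> proj_plane"
  shows "hilbert_function (uniform_ideal S m) d \<le> card S * ((m + 1) choose 2)"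
  unfolding uniform_ideal_def
proof (rule hilbert_INT[OF assms(1)])
  show "rm.subspace (ideal_pow (point_ideal Q) m)" for Q :: "('a ^ 3) set"
    by (rule ideal_pow_ideal)
  show "hilbert_function (ideal_pow (point_ideal Q) m) d \<le> (m + 1) choose 2" if "Q \<in> S" for Q
    using that assms(2) by (intro hilbert_point_power) blast
qed

lemma (in ci_points) in_point_ideal: "Q \<in> X \<Longrightarrow> F \<in> point_ideal Q" "Q \<in> X \<Longrightarrow> G \<in> point_ideal Q"
proof -
  have "F = 1 * F + 0 * G" "G = 0 * F + 1 * G" by simp_all
  then have "F \<in> points_ideal X" "G \<in> points_ideal X"
    unfolding X(4) ideal_gen_pair by blast+
  then show "Q \<in> X \<Longrightarrow> F \<in> point_ideal Q" "Q \<in> X \<Longrightarrow> G \<in> point_ideal Q"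
    by (auto simp: points_ideal_def)
qed

text \<open>Locally at \<open>X\<close> the ideal \<open>(F, G\<^sup>m)\<close> contains the \<open>m\<close>-th power of the point ideals and
  has colength \<open>m\<close>, so \<open>m\<close>-fold points on \<open>X\<close> cannot impose independent conditions in a degree in
  which \<open>(F, G\<^sup>m)\<close> does not have its full Hilbert function.\<close>
lemma (in ci_points) hilbert_uniform_ideal_less:
  assumes ab: "1 \<le> a" "1 \<le> b" and m: "1 \<le> m" and d: "d + 2 < a + m * b"
  shows "hilbert_function (uniform_ideal X m) d < card X * ((m + 1) choose 2)"
proof -
  obtain n where n: "m = Suc n" using m by (metis One_nat_def Suc_le_D)
  interpret pw: regular_forms F "G ^ m" a "m * b" by (rule power)
  define J where "J = ideal_gen {F, G ^ m}"
  have J: "rm.subspace J" by (simp add: J_def ideal_gen_ideal)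
  define I where "I = uniform_ideal X m"
  have I: "rm.subspace I" unfolding I_def by (rule uniform_ideal_ideal)
  define V where "V = I \<inter> forms d"
  have V: "pv.subspace V" unfolding V_def by (rule subspace_ideal_forms[OF I])
  obtain B2 where B2: "finite B2" "card B2 = hilbert_function J d"
    "forms d \<subseteq> pv.span (B2 \<union> (J \<inter> forms d))"
    using hilbert_span[OF J, of d] by metis
  \<comment> \<open>Multiplication by \<open>F\<close> raises the order of vanishing along
    \<open>X\<close>, so the cofactors of \<open>F\<close> matter only modulo the
    \<open>n\<close>-fold points, \<open>n = m - 1\<close>.\<close>
  obtain B1 where B1: "finite B1" "card B1 \<le> card X * ((n + 1) choose 2)"
    "shifted d a \<subseteq> pv.span (B1 \<union> (uniform_ideal X n \<inter> shifted d a))"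
  proof (cases "a \<le> d")
    case True
    obtain B where B: "finite B" "card B = hilbert_function (uniform_ideal X n) (d - a)"
      "forms (d - a) \<subseteq> pv.span (B \<union> (uniform_ideal X n \<inter> forms (d - a)))"
      using hilbert_span[OF uniform_ideal_ideal[of X n], of "d - a"] by metis
    then show ?thesis
      using that[of B] hilbert_uniform_ideal_le[OF X(2,1), of n "d - a"] True
      by (simp add: shifted_def)
  next
    case False
    show ?thesis
      by (rule that[of "{}"]) (use False in \<open>simp_all add: shifted_def pv.span_zero\<close>)
  qed
  have FV: "F * r \<in> V" if r: "r \<in> uniform_ideal X n" "r \<in> shifted d a" for r
  proof -
    have "F * r \<in> I"
      unfolding I_def uniform_ideal_def n
    proof
      fix Q assume "Q \<in> X"
      then show "F * r \<in> ideal_pow (point_ideal Q) (Suc n)"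
        using r(1) by (intro ideal_pow_Suc_mult in_point_ideal) (auto simp: uniform_ideal_def)
    qed
    moreover have "F * r \<in> forms d" using shifted_mult[OF F r(2)] by (simp only: mult.commute)
    ultimately show ?thesis by (simp add: V_def)
  qed
  \<comment> \<open>In \<open>r F + s G^m\<close> the second term already vanishes to order
    \<open>m\<close> on \<open>X\<close>. Modulo \<open>V\<close> the ideal \<open>J\<close>
    therefore contributes at most \<open>card B1\<close> dimensions.\<close>
  have "J \<inter> forms d \<subseteq> pv.span ((*) F ` B1 \<union> V)"
  proof
    fix f assume "f \<in> J \<inter> forms d"
    then obtain r s where rs: "r \<in> shifted d a" "s \<in> shifted d (m * b)" "f = r * F + s * G ^ m"
      using homogeneous_combination[OF _ _ F pw.G] unfolding J_def by blast
    have "s * G ^ m \<in> I"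
      unfolding I_def uniform_ideal_def
    proof
      fix Q assume Q: "Q \<in> X"
      have "G ^ m * s \<in> ideal_pow (point_ideal Q) (m + 0)"
        by (rule ideal_pow_power_mult[OF in_point_ideal(2)[OF Q]]) simp
      then show "s * G ^ m \<in> ideal_pow (point_ideal Q) m" by (simp only: mult.commute add_0_right)
    qed
    then have sV: "s * G ^ m \<in> V" using shifted_mult[OF pw.G rs(2)] by (simp add: V_def)
    have "r \<in> pv.span (B1 \<union> (uniform_ideal X n \<inter> shifted d a))" using B1(3) rs(1) by blast
    then have "F * r \<in> pv.span ((*) F ` (B1 \<union> (uniform_ideal X n \<inter> shifted d a)))"
      by (rule mult_span)
    also have "\<dots> \<subseteq> pv.span ((*) F ` B1 \<union> V)"
      by (rule pv.span_mono) (use FV in blast)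
    finally have "r * F \<in> pv.span ((*) F ` B1 \<union> V)" by (simp only: mult.commute)
    moreover have "s * G ^ m \<in> pv.span ((*) F ` B1 \<union> V)" using sV by (intro pv.span_base) blast
    ultimately show "f \<in> pv.span ((*) F ` B1 \<union> V)" unfolding rs(3) by (rule pv.span_add)
  qed
  then have "B2 \<union> (J \<inter> forms d) \<subseteq> pv.span ((B2 \<union> (*) F ` B1) \<union> V)"
    using pv.span_superset[of "(B2 \<union> (*) F ` B1) \<union> V"]
      pv.span_mono[of "(*) F ` B1 \<union> V" "(B2 \<union> (*) F ` B1) \<union> V"] by blast
  then have "forms d \<subseteq> pv.span ((B2 \<union> (*) F ` B1) \<union> V)"
    by (rule order_trans[OF B2(3) pv.span_minimal[OF _ pv.subspace_span]])
  then have "hilbert_function I d \<le> card (B2 \<union> (*) F ` B1)"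
    unfolding V_def by (intro hilbert_le[OF I]) (simp_all add: B1(1) B2(1))
  also have "\<dots> \<le> card B2 + card ((*) F ` B1)" by (rule card_Un_le)
  also have "\<dots> \<le> hilbert_function J d + card X * ((n + 1) choose 2)"
    using card_image_le[OF B1(1), of "(*) F"] B1(2) B2(2) by linarith
  finally have le: "hilbert_function I d \<le> hilbert_function J d + card X * ((n + 1) choose 2)" .
  have "hilbert_function J d + ((d + 2 - a) choose 2) + ((d + 2 - m * b) choose 2) = (d + 2) choose 2"
    unfolding J_def using d by (intro pw.hilbert_low) simp
  moreover have "(d + 2) choose 2 < a * (m * b) + ((d + 2 - a) choose 2) + ((d + 2 - m * b) choose 2)"
    using ab m d by (intro choose_two_low) simp_all
  ultimately have "hilbert_function J d < a * (m * b)" by linarith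
  \<comment> \<open>As \<open>card X = a b\<close>, the degree of the \<open>m\<close>-fold points
    is \<open>a (m b)\<close>, the degree for \<open>(F, G^m)\<close>, plus that of the
    \<open>(m - 1)\<close>-fold points; the deficit of \<open>J\<close> thus passes to
    \<open>I\<close>.\<close>
  moreover have "(m + 1) choose 2 = m + ((n + 1) choose 2)" by (simp add: n numeral_2_eq_2)
  then have "card X * ((m + 1) choose 2) = a * (m * b) + card X * ((n + 1) choose 2)"
    by (simp add: X(3) algebra_simps)
  ultimately show ?thesis using le unfolding I_def by linarith
qed

section \<open>Jets along a line\<close>

lemma linear_power: "[:0, 1:] ^ n = (monom 1 n :: 'k::comm_ring_1 poly)"
  by (induction n) (simp_all add: monom_0 monom_Suc)

text \<open>Both \<open>F\<close> and \<open>G\<close> restrict to multiples of \<open>s\<close>,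
  with their derivatives along \<open>v\<close> as leading factors, so \<open>F^x G^y K\<close>
  starts in order \<open>x + y\<close> with the product of these factors and the value of
  \<open>K\<close>.\<close>

lemma coeff_psub_monomial:
  assumes "eval3 F q = 0" "eval3 G q = 0"
  shows "j < x + y \<Longrightarrow> coeff (psub q v (F ^ x * (G ^ y * K))) j = 0"
    and "coeff (psub q v (F ^ x * (G ^ y * K))) (x + y) =
      coeff (psub q v F) 1 ^ x * (coeff (psub q v G) 1 ^ y * eval3 K q)"
proof -
  have ex: "\<exists>R'. psub q v R = [:0, 1:] * R' \<and> coeff R' 0 = coeff (psub q v R) 1"
    if "eval3 R q = 0" for R :: "'a poly3"
  proof -
    obtain c R' where R': "psub q v R = pCons c R'" by (rule pCons_cases)
    then have "c = 0" using that coeff_0_psub[of q v R] by simp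
    then show ?thesis using R' by (intro exI[of _ R']) simp
  qed
  obtain F' G' where F': "psub q v F = [:0, 1:] * F'" "coeff F' 0 = coeff (psub q v F) 1"
    and G': "psub q v G = [:0, 1:] * G'" "coeff G' 0 = coeff (psub q v G) 1"
    using ex[OF assms(1)] ex[OF assms(2)] by blast
  define R where "R = F' ^ x * (G' ^ y * psub q v K)"
  have "psub q v (F ^ x * (G ^ y * K)) = [:0, 1:] ^ (x + y) * R"
    by (simp only: psub_mult psub_power F'(1) G'(1) R_def power_mult_distrib power_add mult.assoc
        mult.left_commute[of "F' ^ x"])
  then have eq: "psub q v (F ^ x * (G ^ y * K)) = monom 1 (x + y) * R"
    by (simp only: linear_power)
  show "j < x + y \<Longrightarrow> coeff (psub q v (F ^ x * (G ^ y * K))) j = 0"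
    unfolding eq by (simp add: coeff_monom_mult)
  have "coeff R 0 = coeff F' 0 ^ x * (coeff G' 0 ^ y * eval3 K q)"
    by (simp only: R_def coeff_mult_0 coeff_0_power coeff_0_psub)
  then show "coeff (psub q v (F ^ x * (G ^ y * K))) (x + y) =
      coeff (psub q v F) 1 ^ x * (coeff (psub q v G) 1 ^ y * eval3 K q)"
    unfolding eq by (simp add: coeff_monom_mult F'(2) G'(2))
qed

text \<open>The Leibniz rule for the derivative at \<open>q\<close> in direction
  \<open>v\<close>.\<close>

lemma coeff_1_psub_mult:
  "coeff (psub q v (F * G)) 1 = eval3 F q * coeff (psub q v G) 1 + coeff (psub q v F) 1 * eval3 G q"
  by (simp add: psub_mult coeff_mult coeff_0_psub)

text \<open>Since \<open>(F, G)\<close> is the full ideal of \<open>X\<close>, a multiple of each linear form through \<open>Q\<close> by a form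
  not vanishing at \<open>Q\<close> lies in \<open>(F, G)\<close>; hence \<open>F\<close> and \<open>G\<close> have independent differentials at \<open>Q\<close>.\<close>
lemma (in ci_points) transversal:
  assumes PQ: "P \<in> X" "Q \<in> X" "P \<noteq> Q" and q: "q \<noteq> 0" "Q = vec.span {q}"
  obtains v where "coeff (psub q v F) 1 = z" "coeff (psub q v G) 1 = 1"
proof -
  have q_in: "q \<in> Q" unfolding q(2) by (rule vec.span_base) simp
  have pp: "P \<in> proj_plane" "Q \<in> proj_plane" using PQ X(1) by blast+
  obtain i j k where f: "q $ i \<noteq> 0" "i \<noteq> j" "i \<noteq> k" "j \<noteq> k" using obtain_frame[OF q(1)] .
  obtain H where H: "H \<in> forms (a + b - 3)" "H \<in> points_ideal (X - {P, Q})" "H \<notin> point_ideal Q"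
    using separator[OF PQ] .
  \<comment> \<open>\<open>H\<close> may be nonzero at \<open>P\<close>; the factor \<open>L\<close>
    repairs this, so that \<open>H L\<close> vanishes on all of \<open>X\<close> except at
    \<open>Q\<close>.\<close>
  obtain L where L: "L \<in> forms 1" "L \<in> point_ideal P" "eval3 L q \<noteq> 0"
    using obtain_linear_separator[OF pp PQ(3) q(2)] .
  define h where "h = eval3 (H * L) q"
  have "eval3 H q \<noteq> 0" using form_in_point_ideal[OF H(1)] H(3) q(2) by blast
  then have h: "h \<noteq> 0" using L(3) by (simp add: h_def eval3_mult)
  have F0: "eval3 F q = 0" and G0: "eval3 G q = 0"
    using in_point_ideal[OF PQ(2)] eval3_point_ideal q_in by blast+
  have "(H * L) * lin q i l \<in> points_ideal X" for l
    unfolding points_ideal_def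
  proof
    fix R assume R: "R \<in> X"
    consider "R = P" | "R = Q" | "R \<in> X - {P, Q}" using R by blast
    then show "(H * L) * lin q i l \<in> point_ideal R"
    proof cases
      case 1
      then show ?thesis using L(2)
        by (intro ideal_mult_right[OF point_ideal_ideal] ideal_mult[OF point_ideal_ideal]) simp
    next
      case 2
      then show ?thesis unfolding 2 q(2)
        by (intro ideal_mult[OF point_ideal_ideal] lin_in_point_ideal)
    next
      case 3
      then have "H \<in> point_ideal R" using H(2) by (auto simp: points_ideal_def)
      then show ?thesis by (intro ideal_mult_right[OF point_ideal_ideal])
    qed
  qed
  then have "\<exists>r s. (H * L) * lin q i l = r * F + s * G" for l
    unfolding X(4) ideal_gen_pair .
  then obtain r s where rs: "\<And>l. (H * L) * lin q i l = r l * F + s l * G" by metis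
  define \<rho> \<sigma> where "\<rho> l = eval3 (r l) q" and "\<sigma> l = eval3 (s l) q" for l
  define dF dG where "dF v = coeff (psub q v F) 1" and "dG v = coeff (psub q v G) 1" for v
  \<comment> \<open>The relation differentiated at \<open>q\<close> along \<open>v\<close>; as
    \<open>lin q i l\<close>, \<open>F\<close> and \<open>G\<close> vanish there, only their own
    derivatives survive.\<close>
  have key: "h * (q $ i * v $ l - q $ l * v $ i) = \<rho> l * dF v + \<sigma> l * dG v" for l v
  proof -
    have "coeff (psub q v ((H * L) * lin q i l)) 1 = h * (q $ i * v $ l - q $ l * v $ i)"
      by (simp only: coeff_1_psub_mult[of _ _ "H * L"] eval3_lin h_def) (simp add: psub_lin)
    moreover have "coeff (psub q v (r l * F + s l * G)) 1 = \<rho> l * dF v + \<sigma> l * dG v"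
      by (simp only: psub_add coeff_add coeff_1_psub_mult F0 G0 \<rho>_def \<sigma>_def dF_def dG_def
          mult_zero_right add_0_right)
    ultimately show ?thesis by (simp only: rs)
  qed
  define \<Delta> where "\<Delta> = \<rho> j * \<sigma> k - \<rho> k * \<sigma> j"
  have cramer: "\<Delta> * dF v = h * (\<sigma> k * (q $ i * v $ j - q $ j * v $ i) - \<sigma> j * (q $ i * v $ k - q $ k * v $ i))"
    "\<Delta> * dG v = h * (\<rho> j * (q $ i * v $ k - q $ k * v $ i) - \<rho> k * (q $ i * v $ j - q $ j * v $ i))" for v
  proof -
    have "\<Delta> * dF v = \<sigma> k * (\<rho> j * dF v + \<sigma> j * dG v) - \<sigma> j * (\<rho> k * dF v + \<sigma> k * dG v)"
      by (simp add: \<Delta>_def algebra_simps)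
    then show "\<Delta> * dF v = h * (\<sigma> k * (q $ i * v $ j - q $ j * v $ i) - \<sigma> j * (q $ i * v $ k - q $ k * v $ i))"
      unfolding key[symmetric] by (simp add: algebra_simps)
    have "\<Delta> * dG v = \<rho> j * (\<rho> k * dF v + \<sigma> k * dG v) - \<rho> k * (\<rho> j * dF v + \<sigma> j * dG v)"
      by (simp add: \<Delta>_def algebra_simps)
    then show "\<Delta> * dG v = h * (\<rho> j * (q $ i * v $ k - q $ k * v $ i) - \<rho> k * (q $ i * v $ j - q $ j * v $ i))"
      unfolding key[symmetric] by (simp add: algebra_simps)
  qed
  \<comment> \<open>A singular system would, tested in direction \<open>e_j\<close>, give
    \<open>\<rho> k = \<sigma> k = 0\<close>; then \<open>key\<close> in direction
    \<open>e_k\<close> would give \<open>h * q $ i = 0\<close>.\<close>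
  have \<Delta>: "\<Delta> \<noteq> 0"
  proof
    assume "\<Delta> = 0"
    then have "\<sigma> k = 0" "\<rho> k = 0"
      using cramer[of "axis j 1"] f h by (simp_all add: axis_def)
    then show False using key[of "axis k 1" k] f h by (simp add: axis_def)
  qed
  \<comment> \<open>Chosen so that the left sides of \<open>key\<close> for \<open>l = j, k\<close>
    become \<open>\<rho> l * z + \<sigma> l\<close>; the invertible system then has the unique
    solution \<open>dF v = z\<close>, \<open>dG v = 1\<close>.\<close>
  define v where "v = (\<chi> l. if l = j then (\<rho> j * z + \<sigma> j) / (h * q $ i)
    else if l = k then (\<rho> k * z + \<sigma> k) / (h * q $ i) else 0)"
  have v: "q $ i * v $ j - q $ j * v $ i = (\<rho> j * z + \<sigma> j) / h"
    "q $ i * v $ k - q $ k * v $ i = (\<rho> k * z + \<sigma> k) / h"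
    using f h by (simp_all add: v_def)
  have "\<Delta> * dF v = \<Delta> * z" "\<Delta> * dG v = \<Delta> * 1"
    unfolding cramer v using h by (simp_all add: \<Delta>_def field_simps)
  then have "dF v = z" "dG v = 1" using \<Delta> by simp_all
  then show ?thesis using that[of v] by (simp add: dF_def dG_def)
qed

text \<open>A polynomial function that vanishes on a field of characteristic zero, hence on an
  infinite field, is the zero polynomial.\<close>

lemma coeffs_eq_0:
  fixes c :: "nat \<Rightarrow> 'k::field_char_0"
  assumes "\<And>z. (\<Sum>x\<le>j. c x * z ^ x) = 0" "x \<le> j"
  shows "c x = 0"
proof -
  define p where "p = (\<Sum>x\<le>j. monom (c x) x)"
  have "poly p = poly 0"
    by (rule ext) (simp add: p_def poly_sum poly_monom assms(1))
  then have "coeff p x = 0" by (simp only: poly_eq_poly_eq_iff) simp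
  moreover have "coeff p x = (\<Sum>e\<le>j. if e = x then c e else 0)"
    unfolding p_def coeff_sum by (rule sum.cong) simp_all
  ultimately show ?thesis using assms(2) by simp
qed

text \<open>Independence is proved order by order. A relation modulo the ideal vanishes to order
  \<open>m\<close> on every line through every \<open>Q\<close>; in order \<open>j\<close>, only the
  terms at \<open>Q\<close> with \<open>x + y = j\<close> survive, and varying the line separates
  them.\<close>

lemma hilbert_uniform_ideal_ge:
  fixes F G :: "'k::field_char_0 poly3"
  assumes ci: "ci_points F G a b X" and ab: "1 \<le> a" "a \<le> b" "3 \<le> a + b" and P: "P \<in> X"
    and m: "1 \<le> m"
  shows "card (X - {P}) * ((m + 1) choose 2) \<le> hilbert_function (uniform_ideal (X - {P}) m) (a + m * b - 3)"
proof -
  interpret ci_points F G a b X by (rule ci)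
  define S where "S = X - {P}"
  define t where "t = a + m * b - 3"
  define I where "I = uniform_ideal S m"
  have I: "rm.subspace I" unfolding I_def by (rule uniform_ideal_ideal)
  define sep where "sep Q z \<longleftrightarrow> (case z of (q, i, H) \<Rightarrow>
      q \<noteq> 0 \<and> Q = vec.span {q} \<and> q \<in> Q \<and> q $ i \<noteq> 0 \<and>
      H \<in> forms (a + b - 3) \<and> H \<in> points_ideal (X - {P, Q}) \<and> eval3 H q \<noteq> 0)" for Q z
  have "\<exists>z. sep Q z" if Q: "Q \<in> S" for Q
  proof -
    have QX: "Q \<in> X" "P \<noteq> Q" using Q by (auto simp: S_def)
    then have "Q \<in> proj_plane" using X(1) by blast
    then obtain q where q: "q \<noteq> 0" "Q = vec.span {q}" "q \<in> Q" by (rule obtain_rep)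
    obtain i where i: "q $ i \<noteq> 0" using obtain_frame[OF q(1)] by metis
    obtain H where H: "H \<in> forms (a + b - 3)" "H \<in> points_ideal (X - {P, Q})" "H \<notin> point_ideal Q"
      using separator[OF P QX] .
    have "eval3 H q \<noteq> 0" using form_in_point_ideal[OF H(1)] H(3) q(2) by blast
    then have "sep Q (q, i, H)" using q i H by (simp add: sep_def)
    then show ?thesis by blast
  qed
  then obtain z where z: "\<And>Q. Q \<in> S \<Longrightarrow> sep Q (z Q)" by metis
  define q where "q Q = fst (z Q)" for Q
  define i where "i Q = fst (snd (z Q))" for Q
  define H where "H Q = snd (snd (z Q))" for Q
  have q: "q Q \<noteq> 0" "Q = vec.span {q Q}" "q Q \<in> Q" and i: "q Q $ i Q \<noteq> 0"
    and H: "H Q \<in> forms (a + b - 3)" "H Q \<in> points_ideal (X - {P, Q})" "eval3 (H Q) (q Q) \<noteq> 0"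
    if "Q \<in> S" for Q
    using z[OF that] by (auto simp: q_def i_def H_def sep_def split: prod.splits)
  \<comment> \<open>The separator is padded to the common degree \<open>t\<close> by a coordinate
    that does not vanish at \<open>Q\<close>.\<close>
  define K where "K Q x y = H Q * var (i Q) ^ (t - (x * a + y * b + (a + b - 3)))" for Q x y
  have K0: "eval3 (K Q x y) (q Q) \<noteq> 0" if "Q \<in> S" for Q x y
    using H(3)[OF that] i[OF that] by (simp add: K_def eval3_mult eval3_power eval3_var)
  have K1: "eval3 (K Q' x y) (q Q) = 0" if "Q \<in> S" "Q' \<in> S" "Q' \<noteq> Q" for Q Q' x y
  proof -
    have "H Q' \<in> point_ideal Q"
      using H(2)[OF that(2)] that by (auto simp: points_ideal_def S_def)
    then have "eval3 (H Q') (q Q) = 0" using q(3)[OF that(1)] by (rule eval3_point_ideal)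
    then show ?thesis by (simp add: K_def eval3_mult)
  qed
  define f where "f w = (case w of (Q, x, y) \<Rightarrow> F ^ x * (G ^ y * K Q x y))" for w
  define T where "T = S \<times> {(x, y). x + y < m}"
  have finT: "finite T" using X(2) finite_triangle by (simp add: T_def S_def)
  have "card T \<le> hilbert_function I t"
  proof (rule hilbert_ge[OF I finT, where f = f])
    fix w assume "w \<in> T"
    then obtain Q x y where w: "w = (Q, x, y)" "Q \<in> S" "x + y < m" by (auto simp: T_def)
    obtain n where n: "m = Suc n" using m by (metis One_nat_def Suc_le_D)
    \<comment> \<open>Here \<open>a \<le> b\<close> enters: the largest degree is that of
      \<open>G^(m-1)\<close> times a separator, which is exactly \<open>t\<close>, so the padding
      exponent is not truncated.\<close>
    have "x * a + y * b \<le> (x + y) * b" using ab by (simp add: distrib_right)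
    also have "\<dots> \<le> n * b" using w(3) n by (intro mult_right_mono) simp_all
    finally have le: "x * a + y * b + (a + b - 3) \<le> t"
      using ab by (simp add: t_def n)
    have "f w \<in> forms (x * a + (y * b + ((a + b - 3) + (t - (x * a + y * b + (a + b - 3))) * 1)))"
      unfolding f_def w(1) K_def prod.case
      by (intro forms_mult forms_power F G H w var_in_forms)
    then show "f w \<in> forms t" using le by (simp add: add.assoc)
  next
    fix c assume c: "(\<Sum>w\<in>T. pscale (c w) (f w)) \<in> I"
    have "\<forall>Q\<in>S. \<forall>x y. x + y = j \<longrightarrow> j < m \<longrightarrow> c (Q, x, y) = 0" for j
    proof (induction j rule: less_induct)
      case (less j)
      show ?case
      proof (intro ballI allI impI)
        fix Q x y assume Q: "Q \<in> S" and xy: "x + y = j" and j: "j < m"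
        have QX: "Q \<in> X" "P \<noteq> Q" using Q by (auto simp: S_def)
        have F0: "eval3 F (q Q) = 0" and G0: "eval3 G (q Q) = 0"
          using in_point_ideal[OF QX(1)] eval3_point_ideal q(3)[OF Q] by blast+
        \<comment> \<open>Along a line with derivatives \<open>u\<close> of \<open>F\<close> and
          \<open>1\<close> of \<open>G\<close>, the Taylor coefficient of order \<open>j\<close> is
          the polynomial in \<open>u\<close> with these coefficients.\<close>
        define d where "d x = c (Q, x, j - x) * eval3 (K Q x (j - x)) (q Q)" for x
        have "(\<Sum>x\<le>j. d x * u ^ x) = 0" for u
        proof -
          obtain v where v: "coeff (psub (q Q) v F) 1 = u" "coeff (psub (q Q) v G) 1 = 1"
            using transversal[OF P QX q(1,2)[OF Q]] by metis
          define g where "g w = c w * coeff (psub (q Q) v (f w)) j" for w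
          have "(\<Sum>w\<in>T. pscale (c w) (f w)) \<in> ideal_pow (point_ideal Q) m"
            using c Q by (auto simp: I_def uniform_ideal_def)
          from dvd_psub[OF this q(3)[OF Q], of v]
          obtain r where "psub (q Q) v (\<Sum>w\<in>T. pscale (c w) (f w)) = monom 1 m * r"
            by (auto simp: linear_power elim: dvdE)
          then have "coeff (psub (q Q) v (\<Sum>w\<in>T. pscale (c w) (f w))) j = 0"
            using j by (simp add: coeff_monom_mult)
          then have "0 = (\<Sum>w\<in>T. g w)"
            by (simp add: psub_sum psub_pscale coeff_sum g_def)
          also have "\<dots> = (\<Sum>w\<in>(\<lambda>x. (Q, x, j - x)) ` {..j}. g w)"
          proof (rule sum.mono_neutral_right[OF finT])
            show "(\<lambda>x. (Q, x, j - x)) ` {..j} \<subseteq> T" using Q j by (auto simp: T_def)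
            show "\<forall>w\<in>T - (\<lambda>x. (Q, x, j - x)) ` {..j}. g w = 0"
            proof
              fix w assume w: "w \<in> T - (\<lambda>x. (Q, x, j - x)) ` {..j}"
              then obtain Q' x' y' where w': "w = (Q', x', y')" "Q' \<in> S" "x' + y' < m"
                by (auto simp: T_def)
              \<comment> \<open>Lower orders have zero coefficient by induction, higher orders do
                not reach \<open>s^j\<close>, and terms of another point carry a factor
                \<open>K\<close> that vanishes at \<open>Q\<close>.\<close>
              consider "x' + y' < j" | "j < x' + y'" | "x' + y' = j" "Q' \<noteq> Q"
                | "x' + y' = j" "Q' = Q" by linarith
              then show "g w = 0"
              proof cases
                case 1
                then show ?thesis using less.IH[OF 1] w' by (simp add: g_def)
              next
                case 2
                then show ?thesis
                  unfolding g_def w'(1) f_def prod.case by (simp only: coeff_psub_monomial(1)[OF F0 G0] mult_zero_right)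
              next
                case 3
                then show ?thesis
                  using coeff_psub_monomial(2)[OF F0 G0, of v x' y' "K Q' x' y'"] K1[OF Q w'(2)]
                  by (simp add: g_def w'(1) f_def)
              next
                case 4
                then have "w = (Q, x', j - x')" "x' \<le> j" using w'(1) by auto
                then show ?thesis using w by blast
              qed
            qed
          qed
          also have "\<dots> = (\<Sum>x\<le>j. g (Q, x, j - x))"
            by (subst sum.reindex) (auto simp: inj_on_def)
          also have "\<dots> = (\<Sum>x\<le>j. d x * u ^ x)"
          proof (rule sum.cong[OF refl])
            fix x assume "x \<in> {..j}"
            then have "x + (j - x) = j" by simp
            then show "g (Q, x, j - x) = d x * u ^ x"
              using coeff_psub_monomial(2)[OF F0 G0, of v x "j - x" "K Q x (j - x)"] v
              by (simp add: g_def f_def d_def)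
          qed
          finally show ?thesis by simp
        qed
        then have "d x = 0" by (rule coeffs_eq_0) (use xy in simp)
        then show "c (Q, x, y) = 0" using K0[OF Q] xy by (auto simp: d_def)
      qed
    qed
    then show "\<forall>w\<in>T. c w = 0" by (auto simp: T_def)
  qed
  then show ?thesis by (simp add: T_def card_cartesian_product card_triangle S_def t_def I_def)
qed

theorem corollary5p9:
  fixes X X1 X2 :: "('k::{alg_closed_field, field_char_0} ^ 3) set set"
    and P :: "('k ^ 3) set"
    and d1 d2 m :: nat
  assumes "2 \<le> d1" and "d1 \<le> d2"
    and "complete_intersection X d1 d2"
    and "X = X1 \<union> X2" and "X1 \<inter> X2 = {}"
    and "complete_intersection X1 (d1 - 1) d2"
    and "complete_intersection X2 1 d2"
    and "1 \<le> m"
    and "P \<in> X2"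
  shows "regularity_index (uniform_fat_points X m - {(P, m)}) = d1 + m * d2 - 3"
proof -
  obtain F G where ci: "ci_points F G d1 d2 X" using assms(3) by (rule complete_intersectionE)
  interpret X: ci_points F G d1 d2 X by (rule ci)
  obtain F1 G1 where ci1: "ci_points F1 G1 (d1 - 1) d2 X1"
    using assms(6) by (rule complete_intersectionE)
  interpret X1: ci_points F1 G1 "d1 - 1" d2 X1 by (rule ci1)
  have P: "P \<in> X" using assms(4,9) by blast
  let ?N = "(m + 1) choose 2"
  define W where "W = uniform_fat_points X m - {(P, m)}"
  have W: "W = (\<lambda>Q. (Q, m)) ` (X - {P})" by (auto simp: W_def uniform_fat_points_def)
  have ideal: "fat_ideal W = uniform_ideal (X - {P}) m"
    by (simp add: W fat_ideal_def uniform_ideal_def)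
  have degree: "fat_degree W = card (X - {P}) * ?N"
    unfolding W fat_degree_def by (subst sum.reindex) (auto simp: inj_on_def)
  have "regularity_index W = d1 + m * d2 - 3"
    unfolding regularity_index_def ideal degree
  proof (rule Least_equality)
    have "hilbert_function (uniform_ideal (X - {P}) m) (d1 + m * d2 - 3) \<le> card (X - {P}) * ?N"
      using X.X by (intro hilbert_uniform_ideal_le) auto
    moreover have "card (X - {P}) * ?N \<le> hilbert_function (uniform_ideal (X - {P}) m) (d1 + m * d2 - 3)"
      by (rule hilbert_uniform_ideal_ge[OF ci]) (use assms P in simp_all)
    ultimately show "hilbert_function (uniform_ideal (X - {P}) m) (d1 + m * d2 - 3) = card (X - {P}) * ?N"
      by (rule order_antisym)
  next
    fix i assume i: "hilbert_function (uniform_ideal (X - {P}) m) i = card (X - {P}) * ?N"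
    show "d1 + m * d2 - 3 \<le> i"
    proof (rule ccontr)
      assume "\<not> d1 + m * d2 - 3 \<le> i"
      \<comment> \<open>Exactly the range in which \<open>X1\<close>, of type
        \<open>(d1 - 1, d2)\<close>, fails to impose independent conditions with multiplicity
        \<open>m\<close>.\<close>
      then have "i + 2 < (d1 - 1) + m * d2" using assms(1) by linarith
      then have "hilbert_function (uniform_ideal X1 m) i < card X1 * ?N"
        using assms(1,2,8) by (intro X1.hilbert_uniform_ideal_less) simp_all
      \<comment> \<open>Disjointness keeps \<open>P\<close> out of \<open>X1\<close>; the points of
        \<open>X2 - {P}\<close> add at most their degree, so the strict inequality on
        \<open>X1\<close> persists.\<close>
      moreover have S: "X - {P} = X1 \<union> (X2 - {P})" using assms(4,5,9) by blast
      have "hilbert_function (uniform_ideal (X2 - {P}) m) i \<le> card (X2 - {P}) * ?N"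
        using X.X(1,2) assms(4) by (intro hilbert_uniform_ideal_le) auto
      moreover have "hilbert_function (uniform_ideal (X - {P}) m) i \<le>
          hilbert_function (uniform_ideal X1 m) i + hilbert_function (uniform_ideal (X2 - {P}) m) i"
        unfolding S uniform_ideal_Un by (intro hilbert_Int uniform_ideal_ideal)
      moreover have "card (X - {P}) = card X1 + card (X2 - {P})"
        unfolding S using X.X(2) assms(4,5) by (intro card_Un_disjoint) auto
      ultimately show False using i by (simp add: distrib_right)
    qed
  qed
  then show ?thesis by (simp add: W_def)
qed

end
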